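(* Let $M\in\mathbb R^{m\times m}$ be symmetric positive definite or skew-Hermitian, let $f:\mathbb R^m\to\mathbb R^m$ be sufficiently smooth, and let $y$ be the exact solution on $[t_0,t_{\rm end}]$ of $y'(t)+My(t)=f(y(t))$, $y(t_0)=y_0$. Suppose that $f$ satisfies a local Lipschitz condition in a strip along the exact solution: there exists a real number $L>0$ such that $$\|f(\bar y)-f(\hat y)\|\le L\|\bar y-\hat y\|\qquad\text{for all }\bar y,\hat y\in T_y,\qquad T_y=\Big\{\bar y\in\mathbb R^m:\ \min_{t\in[t_0,t_{\rm end}]}\|y(t)-\bar y\|\le 1\Big\},$$ where $\|\cdot\|$ is the Euclidean norm. Let $\bar a_{ij}$ ($1\le j<i\le4$) and $\bar b_i$ ($1\le i\le 4$) be real constants, let $\bar c_i=\sum_{j=1}^{i-1}\bar a_{ij}$, and suppose that \begin{align*} &\bar b_1+\bar b_2+\bar b_3+\bar b_4=1, && \bar b_2\bar c_2+\bar b_3\bar c_3+\bar b_4\bar c_4=\tfrac12,\\ &\bar b_2\bar c_2^2+\bar b_3\bar c_3^2+\bar b_4\bar c_4^2=\tfrac13, && \bar b_3\bar a_{32}\bar c_2+\bar b_4\bar a_{42}\bar c_2+\bar b_4\bar a_{43}\bar c_3=\tfrac16,\\ &\bar b_2\bar c_2^3+\bar b_3\bar c_3^3+\bar b_4\bar c_4^3=\tfrac14, && \bar b_3\bar c_3\bar a_{32}\bar c_2+\bar b_4\bar c_4\bar a_{42}\bar c_2+\bar b_4\bar c_4\bar a_{43}\bar c_3=\tfrac18,\\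 &\bar b_3\bar a_{32}\bar c_2^2+\bar b_4\bar a_{42}\bar c_2^2+\bar b_4\bar a_{43}\bar c_3^2=\tfrac1{12}, && \bar b_4\bar a_{43}\bar a_{32}\bar c_2=\tfrac1{24}. \end{align*} For a step size $h>0$ let $t_n=t_0+nh$ and let $y_n$ be the numerical solution, started from $y_0$, of the four-stage explicit SVERK method with these coefficients and correction term $\bar w_4(z)$ (the recursion is given in the context). Then there is a constant $C$ such that for $1\le n\le\frac{t_{\rm end}-t_0}{h}$ $$\|y_n-y(t_n)\|\le Ch^4,$$ where $C$ is independent of $n$ and $h$, but depends on $t_{\rm end}$, $\|M\|$ and $f^{(p)}(t_n)$ for $p=0,\ldots,4$.
   Context: The four-stage explicit SVERK (simplified version of exponential Runge--Kutta) method with step size $h$ computes $y_{n+1}$ from $y_n$ by \begin{align*} k_{n,1}&=f(y_n),\\ k_{n,2}&=f\big(e^{-\bar c_2hM}y_n+h\bar a_{21}k_{n,1}\big),\\ k_{n,3}&=f\big(e^{-\bar c_3hM}y_n+h(\bar a_{31}k_{n,1}+\bar a_{32}k_{n,2})\big),\\ k_{n,4}&=f\big(e^{-\bar c_4hM}y_n+h(\bar a_{41}k_{n,1}+\bar a_{42}k_{n,2}+\bar a_{43}k_{n,3})\big),\\ y_{n+1}&=e^{-hM}y_n+h\big(\bar b_1k_{n,1}+\bar b_2k_{n,2}+\bar b_3k_{n,3}+\bar b_4k_{n,4}\big)+\bar w_4(z), \end{align*} where $\bar w_4(z)$ is evaluated at $y_n$ in each step: with $g(y)=-My+f(y)$,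 \begin{align*} \bar w_4(z)=&-\frac{h^2}{2!}Mf(y_n)+\frac{h^3}{3!}\Big((M-f'_y(y_n))Mf(y_n)-Mf'_y(y_n)g(y_n)\Big)\\ &+\frac{h^4}{4!}\Big((-M+f'_y(y_n))M^2f(y_n)+M^2f'_y(y_n)g(y_n)-Mf''_{yy}(y_n)\big(g(y_n),g(y_n)\big)\\ &\quad-Mf'_y(y_n)(-M+f'_y(y_n))g(y_n)-f'_y(y_n)Mf'_y(y_n)g(y_n)\\ &\quad-f'_y(y_n)f'_y(y_n)Mf(y_n)+3f''_{yy}(y_n)\big(-Mf(y_n),g(y_n)\big)\Big). \end{align*} Here $f'_y(y)$ is the Jacobian matrix of $f$ at $y$, $f''_{yy}(y)(u,v)$ is the second derivative of $f$ at $y$ as a symmetric bilinear map applied to $(u,v)$, and the symbol $z$ is only notation indicating dependence on $hM$. In the description of the constant, $f^{(p)}(t_n)$ refers to the derivatives of order $p$ of $f$ along the solution ($p=0$ being $f$ itself). The coefficients of the method are fixed, so $C$ may also depend on them and on $L$. *)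

theory Defs
  imports "HOL-Analysis.Analysis"
begin

section \<open>Matrices\<close>

text \<open>The type \<^typ>\<open>real^'n^'n\<close> carries no matrix algebra instance (its \<open>*\<close> is componentwise),
  so \<^const>\<open>exp\<close> does not apply and the exponential series is written out with \<open>**\<close>.\<close>

definition mat_power :: "real^'n^'n \<Rightarrow> nat \<Rightarrow> real^'n^'n" where
  "mat_power A k = (((**) A) ^^ k) (mat 1)"

definition mat_exp :: "real^'n^'n \<Rightarrow> real^'n^'n" where
  "mat_exp A = (\<Sum>k. (1 / fact k) *\<^sub>R mat_power A k)"

definition symmetric_pos_def :: "real^'n^'n \<Rightarrow> bool" where
  "symmetric_pos_def A \<longleftrightarrow> transpose A = A \<and> (\<forall>x. x \<noteq> 0 \<longrightarrow> x \<bullet> (A *v x) > 0)"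

text \<open>For a real matrix, skew-Hermitian means that the transpose is the negative.\<close>

definition skew_hermitian :: "real^'n^'n \<Rightarrow> bool" where
  "skew_hermitian A \<longleftrightarrow> transpose A = - A"

section \<open>Smoothness and derivatives\<close>

text \<open>\<open>C_diff k f\<close>: \<open>f\<close> is \<open>k\<close> times continuously differentiable on the whole space. In finite
  dimension it suffices to follow the derivative in each fixed direction \<open>v\<close>.\<close>

primrec C_diff :: "nat \<Rightarrow> ('a::euclidean_space \<Rightarrow> 'b::euclidean_space) \<Rightarrow> bool" where
  "C_diff 0 f \<longleftrightarrow> continuous_on UNIV f"
| "C_diff (Suc k) f \<longleftrightarrow>
     f differentiable_on UNIV \<and> (\<forall>v. C_diff k (\<lambda>x. frechet_derivative f (at x) v))"

definition second_deriv :: "('a::euclidean_space \<Rightarrow> 'b::euclidean_space) \<Rightarrow> 'a \<Rightarrow> 'a \<Rightarrow> 'a \<Rightarrow> 'b" where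
  "second_deriv f x u v = frechet_derivative (\<lambda>x'. frechet_derivative f (at x') v) (at x) u"

section \<open>The problem\<close>

definition solves_semilinear ::
  "real^'n^'n \<Rightarrow> (real^'n \<Rightarrow> real^'n) \<Rightarrow> real \<Rightarrow> real \<Rightarrow> real^'n \<Rightarrow> (real \<Rightarrow> real^'n) \<Rightarrow> bool" where
  "solves_semilinear M f t0 tend y0 y \<longleftrightarrow>
     y t0 = y0 \<and>
     (\<forall>t\<in>{t0..tend}. \<exists>y'. (y has_vector_derivative y') (at t within {t0..tend}) \<and>
                         y' + M *v y t = f (y t))"

text \<open>The minimum defining the strip is written as an infimum; it is attained, since a solution
  \<open>y\<close> is continuous on the compact interval.\<close>

definition strip :: "real \<Rightarrow> real \<Rightarrow> (real \<Rightarrow> real^'n) \<Rightarrow> (real^'n) set" where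
  "strip t0 tend y = {v. (INF t\<in>{t0..tend}. norm (y t - v)) \<le> 1}"

section \<open>The four-stage SVERK method\<close>

definition node :: "(nat \<Rightarrow> nat \<Rightarrow> real) \<Rightarrow> nat \<Rightarrow> real" where
  "node a i = (\<Sum>j\<in>{1..<i}. a i j)"

definition sverk4_correction ::
  "real^'n^'n \<Rightarrow> (real^'n \<Rightarrow> real^'n) \<Rightarrow> real \<Rightarrow> real^'n \<Rightarrow> real^'n" where
  "sverk4_correction M f h u =
    (let F = f u; J = jacobian f (at u); H = second_deriv f u; g = - (M *v u) + f u in
       - (h^2 / fact 2) *\<^sub>R (M *v F)
     + (h^3 / fact 3) *\<^sub>R ((M - J) *v (M *v F) - M *v (J *v g))
     + (h^4 / fact 4) *\<^sub>R
         ((- M + J) *v (M *v (M *v F)) + M *v (M *v (J *v g)) - M *v (H g g)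
          - M *v (J *v ((- M + J) *v g)) - J *v (M *v (J *v g))
          - J *v (J *v (M *v F)) + 3 *\<^sub>R H (- (M *v F)) g))"

definition sverk4_step ::
  "real^'n^'n \<Rightarrow> (real^'n \<Rightarrow> real^'n) \<Rightarrow> (nat \<Rightarrow> nat \<Rightarrow> real) \<Rightarrow> (nat \<Rightarrow> real) \<Rightarrow> real
    \<Rightarrow> real^'n \<Rightarrow> real^'n" where
  "sverk4_step M f a b h u =
    (let E = (\<lambda>c. mat_exp (- (c * h) *\<^sub>R M));
         k1 = f u;
         k2 = f (E (node a 2) *v u + h *\<^sub>R (a 2 1 *\<^sub>R k1));
         k3 = f (E (node a 3) *v u + h *\<^sub>R (a 3 1 *\<^sub>R k1 + a 3 2 *\<^sub>R k2));
         k4 = f (E (node a 4) *v u + h *\<^sub>R (a 4 1 *\<^sub>R k1 + a 4 2 *\<^sub>R k2 + a 4 3 *\<^sub>R k3))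
     in E 1 *v u + h *\<^sub>R (b 1 *\<^sub>R k1 + b 2 *\<^sub>R k2 + b 3 *\<^sub>R k3 + b 4 *\<^sub>R k4)
        + sverk4_correction M f h u)"

primrec sverk4 ::
  "real^'n^'n \<Rightarrow> (real^'n \<Rightarrow> real^'n) \<Rightarrow> (nat \<Rightarrow> nat \<Rightarrow> real) \<Rightarrow> (nat \<Rightarrow> real) \<Rightarrow> real
    \<Rightarrow> real^'n \<Rightarrow> nat \<Rightarrow> real^'n" where
  "sverk4 M f a b h y0 0 = y0"
| "sverk4 M f a b h y0 (Suc n) = sverk4_step M f a b h (sverk4 M f a b h y0 n)"

end

theory Submission
  imports Defs
begin

text \<open>The argument is consistency plus stability, with all constants uniform over matrices of norm
  \<open>\<mu>\<close>. The Lipschitz condition on the strip and Gronwall's inequality confine every solution to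
  one ball, on which the derivatives of \<open>f\<close> up to order 4 are bounded. Let \<open>p\<close> be the formal
  degree-4 Taylor polynomial of the flow at a point of the solution. Then \<open>p' - (- M p + f p)\<close> is
  \<open>O(h\<^sup>4)\<close>, so Gronwall's inequality gives \<open>y (t + h) - p h = O(h\<^sup>5)\<close>, while the order
  conditions together with the correction term give \<open>p h\<close> plus \<open>O(h\<^sup>5)\<close> for the numerical
  step. The step has Lipschitz constant \<open>1 + C h\<close> on a slightly larger ball, so the local errors
  add up to \<open>O(h\<^sup>4)\<close> as long as the numerical solution stays there, which it does for small
  \<open>h\<close>. For \<open>h\<close> bounded below there are boundedly many steps, and a crude bound suffices.\<close>

section \<open>Iterated directional derivatives\<close>

text \<open>The constant \<open>C\<close> is chosen before the matrix and the solution, so an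
  estimate for one fixed matrix is of no use. Every expansion is therefore stated for a family over
  a set \<open>S\<close> whose indices bundle a matrix, one or two points and a step size, with a
  single constant for all of \<open>S\<close>; the matrix enters only through its operator norm. The
  order conditions are those of a classical Runge-Kutta method of order 4 and do not involve
  \<open>M\<close>. The stages start from \<open>mat_exp\<close> applied to \<open>u\<close>, which
  reproduces the pure powers of \<open>M\<close> on \<open>u\<close> but loses every term in which
  \<open>M\<close> is applied to \<open>f\<close> or to one of its derivatives; the correction
  restores exactly these. Consistency thus becomes an identity between words in \<open>M\<close> and
  the derivatives of \<open>f\<close> at one point. Passing through the residual of \<open>p\<close>
  means that the solution is differentiated only once, so no chain rule of higher order along it is
  required.\<close>

lemma C_diff_differentiable: "C_diff (Suc k) f \<Longrightarrow> f differentiable (at x)"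
  by (auto simp: differentiable_on_def)

text \<open>The direction is fixed and the base point varies, which is what \<open>C_diff\<close>
  controls. In \<open>ddirs vs f\<close> the last entry of \<open>vs\<close> is differentiated
  first.\<close>

definition ddir :: "'a \<Rightarrow> ('a::euclidean_space \<Rightarrow> 'b::euclidean_space) \<Rightarrow> 'a \<Rightarrow> 'b" where
  "ddir v f = (\<lambda>x. frechet_derivative f (at x) v)"

abbreviation ddirs :: "'a list \<Rightarrow> ('a::euclidean_space \<Rightarrow> 'b::euclidean_space) \<Rightarrow> 'a \<Rightarrow> 'b" where
  "ddirs vs f \<equiv> foldr ddir vs f"

lemma second_deriv_eq_ddirs: "second_deriv f x u v = ddirs [u, v] f x"
  by (simp add: second_deriv_def ddir_def)

lemma has_derivative_ddir:
  assumes "f differentiable (at x)"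
  shows "(f has_derivative (\<lambda>v. ddir v f x)) (at x)"
  using assms by (simp add: ddir_def frechet_derivative_works[symmetric])

lemma ddir_eqI: "(f has_derivative f') (at x) \<Longrightarrow> ddir v f x = f' v"
  unfolding ddir_def using frechet_derivative_at by force

lemma C_diff_ddir: "C_diff (Suc k) f \<Longrightarrow> C_diff k (ddir v f)"
  by (simp add: ddir_def)

lemma C_diff_SucD: "C_diff (Suc k) f \<Longrightarrow> C_diff k f"
proof (induction k arbitrary: f)
  case 0
  then show ?case by (simp add: differentiable_imp_continuous_on)
next
  case (Suc k)
  then show ?case by (metis C_diff.simps(2))
qed

lemma C_diff_mono: "C_diff k f \<Longrightarrow> j \<le> k \<Longrightarrow> C_diff j f"
  by (induction k) (use C_diff_SucD le_Suc_eq in blast)+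

lemma C_diff_ddirs: "C_diff (k + length vs) f \<Longrightarrow> C_diff k (ddirs vs f)"
  by (induction vs arbitrary: k) (auto simp: C_diff_ddir simp del: C_diff.simps(2))

lemma ddir_lincomb:
  assumes "finite A" "\<And>b. b \<in> A \<Longrightarrow> F b differentiable (at x)"
  shows "ddir v (\<lambda>x. \<Sum>b\<in>A. c b *\<^sub>R F b x) x = (\<Sum>b\<in>A. c b *\<^sub>R ddir v (F b) x)"
  by (rule ddir_eqI) (auto intro!: derivative_eq_intros has_derivative_ddir assms)

lemma ddirs_lincomb:
  assumes "finite A" "\<And>b. b \<in> A \<Longrightarrow> C_diff (length vs) (F b)"
  shows "ddirs vs (\<lambda>x. \<Sum>b\<in>A. c b *\<^sub>R F b x) = (\<lambda>x. \<Sum>b\<in>A. c b *\<^sub>R ddirs vs (F b) x)"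
  using assms(2)
proof (induction vs)
  case (Cons v vs)
  have "F b differentiable at x" "C_diff (length vs) (F b)" if "b \<in> A" for b x
    using Cons.prems[OF that] C_diff_SucD[of "length vs"] C_diff_differentiable[of "length vs"]
    by (auto simp del: C_diff.simps)
  moreover have "ddirs vs (F b) differentiable at x" if "b \<in> A" for b x
    using Cons.prems[OF that] C_diff_ddirs[of "Suc 0" vs "F b"] by (intro C_diff_differentiable[of 0]) (simp del: C_diff.simps)
  ultimately show ?case
    using Cons.IH by (auto intro!: ext ddir_lincomb assms(1))
qed simp

lemma ddir_linear:
  assumes "f differentiable (at x)"
  shows "linear (\<lambda>v. ddir v f x)"
  using assms has_derivative_ddir has_derivative_linear by blast

text \<open>The function \<open>ddirs vs f\<close> is differentiable, hence its derivative is linear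
  in the direction, and the outer derivatives \<open>ws\<close> respect finite linear combinations.
  With the slot in the middle, one statement covers each argument of a higher derivative.\<close>

lemma linear_ddirs:
  fixes f :: "'a::euclidean_space \<Rightarrow> 'b::euclidean_space"
  assumes "C_diff (Suc (length ws + length vs)) f"
  shows "linear (\<lambda>v. ddirs (ws @ v # vs) f x)"
proof -
  define g where "g = ddirs vs f"
  have g: "C_diff (Suc (length ws)) g"
    using assms C_diff_ddirs[of "Suc (length ws)" vs f] by (simp add: g_def del: C_diff.simps)
  have lin: "linear (\<lambda>v. ddir v g x)" for x
    by (rule ddir_linear, rule C_diff_differentiable[OF g])
  have c: "C_diff (length ws) (ddir v g)" for v
    by (rule C_diff_ddir[OF g])
  show ?thesis
  proof (rule linearI)
    fix v w :: 'a
    \<comment> \<open>Indexing by \<open>{True, False}\<close> makes the sum of two functions an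
      instance of \<open>ddirs_lincomb\<close>.\<close>
    have "ddir (v + w) g = (\<lambda>x. \<Sum>b\<in>{True, False}. 1 *\<^sub>R ddir (if b then v else w) g x)"
      using linear_add[OF lin] by (simp add: fun_eq_iff)
    then have "ddirs ws (ddir (v + w) g) x
        = (\<Sum>b\<in>{True, False}. 1 *\<^sub>R ddirs ws (ddir (if b then v else w) g) x)"
      by (simp only: ddirs_lincomb[OF _ c] finite_insert finite.emptyI)
    then show "ddirs (ws @ (v + w) # vs) f x = ddirs (ws @ v # vs) f x + ddirs (ws @ w # vs) f x"
      by (simp add: g_def)
  next
    fix v :: 'a and c :: real
    have "ddir (c *\<^sub>R v) g = (\<lambda>x. \<Sum>b\<in>{True}. c *\<^sub>R ddir v g x)"
      using linear_scale[OF lin] by (simp add: fun_eq_iff)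
    then have "ddirs ws (ddir (c *\<^sub>R v) g) x = (\<Sum>b\<in>{True}. c *\<^sub>R ddirs ws (ddir v g) x)"
      by (simp only: ddirs_lincomb[OF _ c] finite_insert finite.emptyI)
    then show "ddirs (ws @ (c *\<^sub>R v) # vs) f x = c *\<^sub>R ddirs (ws @ v # vs) f x"
      by (simp add: g_def)
  qed
qed

text \<open>\<open>C_diff\<close> treats one list of directions at a time. Uniformity over all lists
  comes from expanding the innermost direction in the basis: the finitely many functions
  \<open>ddir b f\<close> fall under the induction hypothesis, hence the generalisation over
  \<open>f\<close>.\<close>

lemma ddirs_bounded:
  fixes f :: "'a::euclidean_space \<Rightarrow> 'b::euclidean_space"
  assumes "C_diff k f"
  shows "\<exists>B\<ge>0. \<forall>x vs. norm x \<le> R \<and> length vs = k \<longrightarrow> norm (ddirs vs f x) \<le> B * prod_list (map norm vs)"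
  using assms
proof (induction k arbitrary: f)
  case 0
  have "compact (f ` cball 0 R)"
    using 0 by (intro compact_continuous_image) (auto intro: continuous_on_subset)
  then obtain B where "\<And>x. x \<in> f ` cball 0 R \<Longrightarrow> norm x \<le> B"
    using compact_imp_bounded bounded_iff by metis
  then have "norm (f x) \<le> max 0 B" if "norm x \<le> R" for x
    using that by (simp add: le_max_iff_disj)
  then show ?case by (intro exI[of _ "max 0 B"]) auto
next
  case (Suc k)
  have c: "C_diff k (ddir b f)" for b
    by (rule C_diff_ddir[OF Suc.prems])
  obtain B where B0: "\<And>b. 0 \<le> B b"
    and B: "\<And>b x vs. norm x \<le> R \<Longrightarrow> length vs = k
              \<Longrightarrow> norm (ddirs vs (ddir b f) x) \<le> B b * prod_list (map norm vs)"
    using Suc.IH[OF c] by metis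
  define C where "C = (\<Sum>b\<in>Basis. B b)"
  have "norm (ddirs vs f x) \<le> C * prod_list (map norm vs)" if x: "norm x \<le> R" and l: "length vs = Suc k" for x vs
  proof -
    obtain ws v where vs: "vs = ws @ [v]" and lw: "length ws = k"
      using l by (metis length_Suc_conv_rev)
    have "linear (\<lambda>v. ddir v f y)" for y
      by (rule ddir_linear, rule C_diff_differentiable[OF Suc.prems])
    then have "ddir (\<Sum>b\<in>Basis. (v \<bullet> b) *\<^sub>R b) f y = (\<Sum>b\<in>Basis. (v \<bullet> b) *\<^sub>R ddir b f y)" for y
      by (simp add: linear_sum[of "\<lambda>v. ddir v f y"] linear_scale[of "\<lambda>v. ddir v f y"])
    then have "ddir v f = (\<lambda>y. \<Sum>b\<in>Basis. (v \<bullet> b) *\<^sub>R ddir b f y)"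
      by (simp add: euclidean_representation fun_eq_iff)
    then have "ddirs vs f x = (\<Sum>b\<in>Basis. (v \<bullet> b) *\<^sub>R ddirs ws (ddir b f) x)"
      by (simp add: vs ddirs_lincomb c lw)
    also have "norm \<dots> \<le> (\<Sum>b\<in>Basis. norm v * (B b * prod_list (map norm ws)))"
      by (rule sum_norm_le) (auto intro!: mult_mono B x lw Basis_le_norm)
    also have "\<dots> = C * prod_list (map norm vs)"
      by (simp add: vs C_def sum_distrib_left sum_distrib_right mult_ac)
    finally show ?thesis .
  qed
  moreover have "0 \<le> C" unfolding C_def by (intro sum_nonneg B0)
  ultimately show ?case by blast
qed

section \<open>Taylor's formula with a remainder uniform on balls\<close>

lemma taylor_direction:
  fixes G :: "nat \<Rightarrow> 'a::euclidean_space \<Rightarrow> 'b::euclidean_space"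
  assumes n: "0 < n"
    and diff: "\<And>k x. k < n \<Longrightarrow> G k differentiable (at x)"
    and G: "\<And>k x. k < n \<Longrightarrow> ddir d (G k) x = G (Suc k) x"
    and B: "\<And>s. 0 \<le> s \<Longrightarrow> s \<le> 1 \<Longrightarrow> norm (G n (u + s *\<^sub>R d)) \<le> B"
  shows "norm (G 0 (u + d) - (\<Sum>k<n. (1 / fact k) *\<^sub>R G k u)) \<le> B"
proof -
  define r where "r = G 0 (u + d) - (\<Sum>k<n. (1 / fact k) *\<^sub>R G k u)"
  \<comment> \<open>The Lagrange remainder is a statement about real functions. Pairing with the
    error \<open>r\<close> itself makes \<open>r \<bullet> r\<close> such a remainder, and
    Cauchy-Schwarz bounds it by \<open>norm r * B\<close>.\<close>
  define \<phi> where "\<phi> k s = r \<bullet> G k (u + s *\<^sub>R d)" for k s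
  have "DERIV (\<phi> k) s :> \<phi> (Suc k) s" if "k < n" for k s
  proof -
    have "(G k has_derivative (\<lambda>v. ddir v (G k) (u + s *\<^sub>R d))) (at (u + s *\<^sub>R d))"
      by (rule has_derivative_ddir[OF diff[OF that]])
    then have "((\<lambda>s. G k (u + s *\<^sub>R d)) has_derivative (\<lambda>t. ddir (t *\<^sub>R d) (G k) (u + s *\<^sub>R d))) (at s)"
      by (rule has_derivative_compose[rotated]) (auto intro!: derivative_eq_intros)
    moreover have "ddir (t *\<^sub>R d) (G k) x = t *\<^sub>R ddir d (G k) x" for t x
      by (rule linear_scale[OF ddir_linear[OF diff[OF that]]])
    ultimately show ?thesis
      unfolding \<phi>_def has_field_derivative_def using G[OF that]
      by (auto intro!: derivative_eq_intros)
  qed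
  then obtain t where t: "0 < t" "t < 1"
      "\<phi> 0 1 = (\<Sum>m<n. \<phi> m 0 / fact m * 1 ^ m) + \<phi> n t / fact n * 1 ^ n"
    using Maclaurin[of 1 n \<phi> "\<phi> 0"] n by auto
  have "r \<bullet> r = \<phi> 0 1 - (\<Sum>m<n. \<phi> m 0 / fact m * 1 ^ m)"
    by (subst (2) r_def) (simp add: inner_diff_right inner_sum_right \<phi>_def)
  also have "\<dots> = \<phi> n t / fact n"
    using t(3) by simp
  also have "\<dots> \<le> \<bar>\<phi> n t\<bar> / 1"
    by (intro frac_le) auto
  also have "\<dots> = \<bar>\<phi> n t\<bar>" by simp
  also have "\<dots> \<le> norm r * norm (G n (u + t *\<^sub>R d))"
    unfolding \<phi>_def by (rule Cauchy_Schwarz_ineq2)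
  also have "\<dots> \<le> norm r * B"
    using B[of t] t by (intro mult_left_mono) auto
  finally have "norm r * norm r \<le> norm r * B"
    by (simp add: power2_norm_eq_inner[symmetric] power2_eq_square)
  moreover have "0 \<le> B" using order_trans[OF norm_ge_zero B[of 0]] by simp
  ultimately have "norm r \<le> B" by (cases "r = 0") (auto simp: mult_le_cancel_left_pos)
  then show ?thesis by (simp add: r_def)
qed

lemma ddirs_taylor_uniform:
  fixes f :: "'a::euclidean_space \<Rightarrow> 'b::euclidean_space"
  assumes "C_diff (n + l) f" "0 < n"
  shows "\<exists>B\<ge>0. \<forall>u d vs. norm u \<le> R \<and> norm d \<le> R \<and> length vs = l \<longrightarrow>
    norm (ddirs vs f (u + d) - (\<Sum>k<n. (1 / fact k) *\<^sub>R ddirs (replicate k d @ vs) f u))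
      \<le> B * norm d ^ n * prod_list (map norm vs)"
proof -
  \<comment> \<open>The segment from \<open>u\<close> to \<open>u + d\<close> stays in the ball of
    radius \<open>2 * R\<close>.\<close>
  obtain B where B: "B \<ge> 0" "\<And>x ws. norm x \<le> 2 * R \<Longrightarrow> length ws = n + l
      \<Longrightarrow> norm (ddirs ws f x) \<le> B * prod_list (map norm ws)"
    using ddirs_bounded[OF assms(1), of "2 * R"] by blast
  have "norm (ddirs vs f (u + d) - (\<Sum>k<n. (1 / fact k) *\<^sub>R ddirs (replicate k d @ vs) f u))
      \<le> B * norm d ^ n * prod_list (map norm vs)" if "norm u \<le> R" "norm d \<le> R" "length vs = l" for u d vs
  proof -
    define G where "G k = ddirs (replicate k d @ vs) f" for k
    have "norm (G 0 (u + d) - (\<Sum>k<n. (1 / fact k) *\<^sub>R G k u)) \<le> B * norm d ^ n * prod_list (map norm vs)"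
    proof (rule taylor_direction[OF assms(2), where d = d])
      fix k x assume "k < n"
      then have "C_diff (Suc 0 + length (replicate k d @ vs)) f"
        by (intro C_diff_mono[OF assms(1)]) (use that in auto)
      then show "G k differentiable (at x)"
        using C_diff_ddirs[of "Suc 0"] C_diff_differentiable unfolding G_def by blast
    next
      fix s :: real assume s: "0 \<le> s" "s \<le> 1"
      then have "norm (s *\<^sub>R d) \<le> norm d"
        by (simp add: mult_left_le_one_le)
      then have "norm (u + s *\<^sub>R d) \<le> 2 * R"
        using norm_triangle_ineq[of u "s *\<^sub>R d"] that by linarith
      then have "norm (G n (u + s *\<^sub>R d)) \<le> B * prod_list (map norm (replicate n d @ vs))"
        unfolding G_def by (rule B(2)) (use that in simp)
      also have "prod_list (map norm (replicate n d @ vs)) = norm d ^ n * prod_list (map norm vs)"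
        by (induction n) auto
      finally show "norm (G n (u + s *\<^sub>R d)) \<le> B * norm d ^ n * prod_list (map norm vs)"
        by (simp add: mult_ac)
    qed (simp add: G_def)
    then show ?thesis by (simp add: G_def)
  qed
  then show ?thesis using B(1) by blast
qed

lemma ddirs_taylor:
  fixes f :: "'a::euclidean_space \<Rightarrow> 'b::euclidean_space"
  assumes "C_diff (n + length vs) f" "0 < n"
  shows "\<exists>B\<ge>0. \<forall>u d. norm u \<le> R \<and> norm d \<le> R \<longrightarrow>
    norm (ddirs vs f (u + d) - (\<Sum>k<n. (1 / fact k) *\<^sub>R ddirs (replicate k d @ vs) f u))
      \<le> B * norm d ^ n * prod_list (map norm vs)"
  using ddirs_taylor_uniform[OF assms, of R] by blast

lemma ddirs_lipschitz:
  fixes f :: "'a::euclidean_space \<Rightarrow> 'b::euclidean_space"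
  assumes "C_diff (Suc l) f"
  shows "\<exists>B\<ge>0. \<forall>u v vs. norm u \<le> R \<and> norm v \<le> R \<and> length vs = l \<longrightarrow>
    norm (ddirs vs f u - ddirs vs f v) \<le> B * prod_list (map norm vs) * norm (u - v)"
proof -
  obtain B where B: "B \<ge> 0" "\<And>u d vs. norm u \<le> max 0 (2 * R) \<Longrightarrow> norm d \<le> max 0 (2 * R) \<Longrightarrow> length vs = l \<Longrightarrow>
      norm (ddirs vs f (u + d) - ddirs vs f u) \<le> B * norm d * prod_list (map norm vs)"
    using ddirs_taylor_uniform[of 1 l f "max 0 (2 * R)"] assms by (auto simp del: C_diff.simps)
  show ?thesis
  proof (intro exI conjI allI impI)
    show "0 \<le> B" by (rule B(1))
    fix u v :: 'a and vs :: "'a list" assume "norm u \<le> R \<and> norm v \<le> R \<and> length vs = l"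
    moreover from this have "norm (u - v) \<le> 2 * R" using norm_triangle_ineq4[of u v] by linarith
    ultimately show "norm (ddirs vs f u - ddirs vs f v) \<le> B * prod_list (map norm vs) * norm (u - v)"
      using B(2)[of v "u - v" vs] norm_ge_zero[of v] by (simp add: mult_ac)
  qed
qed

text \<open>Schwarz's theorem: the second difference \<open>f (x + s u + s v) - f (x + s u) - f (x + s v) + f x\<close>
  is symmetric in \<open>u\<close>, \<open>v\<close> and equals \<open>s\<^sup>2 f'' x u v\<close> up to \<open>O(s\<^sup>3)\<close>.\<close>

lemma second_difference:
  fixes f :: "'a::euclidean_space \<Rightarrow> 'b::euclidean_space"
  assumes f: "C_diff 3 f"
  shows "\<exists>C. \<forall>s. 0 \<le> s \<and> s \<le> 1 \<longrightarrow>
    norm (f (x + s *\<^sub>R u + s *\<^sub>R v) - f (x + s *\<^sub>R u) - f (x + s *\<^sub>R v) + f x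
          - s\<^sup>2 *\<^sub>R ddirs [u, v] f x) \<le> C * s ^ 3"
proof -
  define R where "R = norm x + norm u + norm v"
  obtain B3 where B3: "B3 \<ge> 0" "\<And>y d. norm y \<le> R \<Longrightarrow> norm d \<le> R \<Longrightarrow>
      norm (f (y + d) - (f y + ddirs [d] f y + (1/2) *\<^sub>R ddirs [d, d] f y)) \<le> B3 * norm d ^ 3"
    using ddirs_taylor[of 3 "[]" f R] f by (auto simp: eval_nat_numeral simp del: C_diff.simps)
  obtain B2 where B2: "B2 \<ge> 0" "\<And>y d. norm y \<le> R \<Longrightarrow> norm d \<le> R \<Longrightarrow>
      norm (ddirs [v] f (y + d) - (ddirs [v] f y + ddirs [d, v] f y)) \<le> B2 * norm d ^ 2 * norm v"
    using ddirs_taylor[of 2 "[v]" f R] f by (auto simp: eval_nat_numeral simp del: C_diff.simps)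
  obtain B1 where B1: "B1 \<ge> 0" "\<And>y d. norm y \<le> R \<Longrightarrow> norm d \<le> R \<Longrightarrow>
      norm (ddirs [v, v] f (y + d) - ddirs [v, v] f y) \<le> B1 * norm d * (norm v * norm v)"
    using ddirs_taylor[of 1 "[v, v]" f R] f by (auto simp: eval_nat_numeral simp del: C_diff.simps)
  have l1: "linear (\<lambda>w. ddirs [w] f y)" for y
    using linear_ddirs[of "[]" "[]" f y] C_diff_mono[OF f, of 1] by (simp del: C_diff.simps)
  have l2: "linear (\<lambda>w. ddirs [w, z] f y)" "linear (\<lambda>w. ddirs [z, w] f y)" for y z
    using linear_ddirs[of "[]" "[z]" f y] linear_ddirs[of "[z]" "[]" f y] C_diff_mono[OF f, of 2]
    by (simp_all add: eval_nat_numeral del: C_diff.simps)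
  note scale = linear_scale[OF l1] linear_scale[OF l2(1)] linear_scale[OF l2(2)]
  define C where "C = 2 * (B3 * norm v ^ 3) + B2 * norm u ^ 2 * norm v + B1 * norm u * (norm v * norm v)"
  have "norm (f (x + s *\<^sub>R u + s *\<^sub>R v) - f (x + s *\<^sub>R u) - f (x + s *\<^sub>R v) + f x
          - s\<^sup>2 *\<^sub>R ddirs [u, v] f x) \<le> C * s ^ 3" if s: "0 \<le> s" "s \<le> 1" for s
  proof -
    have su: "norm (s *\<^sub>R w) \<le> norm w" for w :: 'a using s by (simp add: mult_left_le_one_le)
    have R: "norm x \<le> R" "norm (s *\<^sub>R u) \<le> R" "norm (s *\<^sub>R v) \<le> R" "norm (x + s *\<^sub>R u) \<le> R"
      using su[of u] su[of v] norm_triangle_ineq[of x "s *\<^sub>R u"] norm_ge_zero[of x] norm_ge_zero[of u] norm_ge_zero[of v]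
      unfolding R_def by linarith+
    \<comment> \<open>\<open>R1\<close> and \<open>R2\<close> are Taylor remainders of the
      differences in direction \<open>v\<close>, based at \<open>x + s *\<^sub>R u\<close> and at
      \<open>x\<close>. \<open>R3\<close> and \<open>R4\<close> compare the first and second
      derivatives along \<open>v\<close> at these two base points, \<open>R3\<close> after removal
      of its linear part.\<close>
    define R1 where "R1 = f (x + s *\<^sub>R u + s *\<^sub>R v) - (f (x + s *\<^sub>R u) + ddirs [s *\<^sub>R v] f (x + s *\<^sub>R u)
         + (1/2) *\<^sub>R ddirs [s *\<^sub>R v, s *\<^sub>R v] f (x + s *\<^sub>R u))"
    define R2 where "R2 = f (x + s *\<^sub>R v) - (f x + ddirs [s *\<^sub>R v] f x + (1/2) *\<^sub>R ddirs [s *\<^sub>R v, s *\<^sub>R v] f x)"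
    define R3 where "R3 = ddirs [v] f (x + s *\<^sub>R u) - (ddirs [v] f x + ddirs [s *\<^sub>R u, v] f x)"
    define R4 where "R4 = ddirs [v, v] f (x + s *\<^sub>R u) - ddirs [v, v] f x"
    have n1: "norm R1 \<le> B3 * norm v ^ 3 * s ^ 3"
      unfolding R1_def using B3(2)[OF R(4) R(3)] s by (simp add: power_mult_distrib mult_ac)
    have n2: "norm R2 \<le> B3 * norm v ^ 3 * s ^ 3"
      unfolding R2_def using B3(2)[OF R(1) R(3)] s by (simp add: power_mult_distrib mult_ac)
    have "norm R3 \<le> B2 * norm u ^ 2 * norm v * s ^ 2"
      unfolding R3_def using B2(2)[OF R(1) R(2)] s by (simp add: power_mult_distrib mult_ac)
    then have "s * norm R3 \<le> s * (B2 * norm u ^ 2 * norm v * s ^ 2)"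
      using s by (intro mult_left_mono)
    then have n3: "norm (s *\<^sub>R R3) \<le> B2 * norm u ^ 2 * norm v * s ^ 3"
      using s by (simp add: power2_eq_square power3_eq_cube mult_ac)
    have n40: "norm R4 \<le> B1 * norm u * (norm v * norm v) * s"
      unfolding R4_def using B1(2)[OF R(1) R(2)] s by (simp add: mult_ac)
    have "s\<^sup>2 / 2 * norm R4 \<le> s\<^sup>2 * norm R4"
      by (intro mult_right_mono) auto
    also have "\<dots> \<le> s\<^sup>2 * (B1 * norm u * (norm v * norm v) * s)"
      using s n40 by (intro mult_left_mono) auto
    finally have n4: "norm ((s\<^sup>2 / 2) *\<^sub>R R4) \<le> B1 * norm u * (norm v * norm v) * s ^ 3"
      using s by (simp add: power2_eq_square power3_eq_cube mult_ac)
    have "f (x + s *\<^sub>R u + s *\<^sub>R v) - f (x + s *\<^sub>R u) - f (x + s *\<^sub>R v) + f x - s\<^sup>2 *\<^sub>R ddirs [u, v] f x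
        = R1 - R2 + s *\<^sub>R R3 + (s\<^sup>2 / 2) *\<^sub>R R4"
      unfolding R1_def R2_def R3_def R4_def scale
      by (simp add: algebra_simps power2_eq_square del: foldr.simps)
    also have "norm \<dots> \<le> norm R1 + norm R2 + norm (s *\<^sub>R R3) + norm ((s\<^sup>2 / 2) *\<^sub>R R4)"
      by (meson add_mono norm_triangle_ineq norm_triangle_ineq4 order_trans order_refl)
    also have "\<dots> \<le> C * s ^ 3"
      using n1 n2 n3 n4 by (simp add: C_def algebra_simps)
    finally show ?thesis .
  qed
  then show ?thesis by blast
qed

lemma second_deriv_symmetric:
  fixes f :: "'a::euclidean_space \<Rightarrow> 'b::euclidean_space"
  assumes f: "C_diff 3 f"
  shows "ddirs [u, v] f x = ddirs [v, u] f x"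
proof -
  obtain C1 where C1: "\<And>s. 0 \<le> s \<Longrightarrow> s \<le> 1 \<Longrightarrow>
    norm (f (x + s *\<^sub>R u + s *\<^sub>R v) - f (x + s *\<^sub>R u) - f (x + s *\<^sub>R v) + f x
          - s\<^sup>2 *\<^sub>R ddirs [u, v] f x) \<le> C1 * s ^ 3"
    using second_difference[OF f] by metis
  obtain C2 where C2: "\<And>s. 0 \<le> s \<Longrightarrow> s \<le> 1 \<Longrightarrow>
    norm (f (x + s *\<^sub>R v + s *\<^sub>R u) - f (x + s *\<^sub>R v) - f (x + s *\<^sub>R u) + f x
          - s\<^sup>2 *\<^sub>R ddirs [v, u] f x) \<le> C2 * s ^ 3"
    using second_difference[OF f] by metis
  define N where "N = norm (ddirs [u, v] f x - ddirs [v, u] f x)"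
  have bound: "N \<le> (C1 + C2) * s" if s: "0 < s" "s \<le> 1" for s
  proof -
    let ?D = "f (x + s *\<^sub>R u + s *\<^sub>R v) - f (x + s *\<^sub>R u) - f (x + s *\<^sub>R v) + f x"
    have "norm (?D - s\<^sup>2 *\<^sub>R ddirs [u, v] f x) \<le> C1 * s ^ 3"
      using C1 s by simp
    moreover have "norm (?D - s\<^sup>2 *\<^sub>R ddirs [v, u] f x) \<le> C2 * s ^ 3"
      using C2[of s] s by (simp add: algebra_simps)
    ultimately have "norm ((?D - s\<^sup>2 *\<^sub>R ddirs [v, u] f x) - (?D - s\<^sup>2 *\<^sub>R ddirs [u, v] f x)) \<le> (C1 + C2) * s ^ 3"
      using norm_triangle_ineq4[of "?D - s\<^sup>2 *\<^sub>R ddirs [v, u] f x" "?D - s\<^sup>2 *\<^sub>R ddirs [u, v] f x"]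
      by (simp only: distrib_right)
    also have "(?D - s\<^sup>2 *\<^sub>R ddirs [v, u] f x) - (?D - s\<^sup>2 *\<^sub>R ddirs [u, v] f x)
        = s\<^sup>2 *\<^sub>R (ddirs [u, v] f x - ddirs [v, u] f x)"
      by (simp only: scaleR_diff_right) simp
    finally have "s\<^sup>2 * N \<le> s\<^sup>2 * ((C1 + C2) * s)"
      by (simp add: N_def power2_eq_square power3_eq_cube mult_ac del: foldr.simps)
    then show ?thesis using s by simp
  qed
  have "((\<lambda>s. (C1 + C2) * s) \<longlongrightarrow> (C1 + C2) * 0) (at_right 0)"
    by (intro tendsto_intros)
  moreover have "eventually (\<lambda>s. N \<le> (C1 + C2) * s) (at_right 0)"
    unfolding eventually_at_right_field using bound by (intro exI[of _ 1]) auto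
  ultimately have "N \<le> (C1 + C2) * 0"
    by (intro tendsto_lowerbound) auto
  then show ?thesis by (simp add: N_def)
qed

section \<open>The matrix exponential\<close>

lemma mat_power_mult_vec: "mat_power A k *v x = ((*v) A ^^ k) x"
  by (induction k) (auto simp: mat_power_def simp flip: matrix_vector_mul_assoc)

text \<open>The exponential series is summed in the Euclidean norm of the entries, while powers are
  controlled in the operator norm; this comparison links the two.\<close>

lemma norm_matrix_le_onorm:
  fixes A :: "real^'n^'n"
  shows "norm A \<le> real CARD('n) * (real CARD('n) * onorm ((*v) A))"
proof -
  have "norm (A $ i) \<le> real CARD('n) * onorm ((*v) A)" for i
  proof -
    have "norm (A $ i) \<le> (\<Sum>j\<in>UNIV. \<bar>A $ i $ j\<bar>)" by (rule norm_le_l1_cart)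
    also have "\<dots> \<le> (\<Sum>j\<in>(UNIV :: 'n set). onorm ((*v) A))"
      by (intro sum_mono matrix_component_le_onorm)
    finally show ?thesis by simp
  qed
  moreover have "norm A \<le> (\<Sum>i\<in>UNIV. norm (A $ i))"
    unfolding norm_vec_def by (rule L2_set_le_sum) auto
  ultimately show ?thesis
    using sum_mono[of "UNIV :: 'n set" "\<lambda>i. norm (A $ i)" "\<lambda>_. real CARD('n) * onorm ((*v) A)"]
    by simp
qed

lemma norm_funpow_le:
  fixes A :: "'a::real_normed_vector \<Rightarrow> 'a"
  assumes "\<And>v. norm (A v) \<le> \<theta> * norm v" "0 \<le> \<theta>"
  shows "norm ((A ^^ k) x) \<le> \<theta> ^ k * norm x"
proof (induction k)
  case (Suc k)
  have "norm ((A ^^ Suc k) x) \<le> \<theta> * norm ((A ^^ k) x)"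
    using assms(1)[of "(A ^^ k) x"] by (simp only: funpow.simps o_apply)
  also have "\<dots> \<le> \<theta> * (\<theta> ^ k * norm x)" using Suc assms(2) by (intro mult_left_mono)
  finally show ?case by simp
qed simp

text \<open>Summability is first needed among matrices, where \<open>mat_exp\<close> is defined. The
  bounded linear map \<open>\<lambda>A. A *v x\<close> then carries the series to vectors, and
  matrix powers become iterates.\<close>

lemma mat_exp_sums:
  fixes A :: "real^'n^'n"
  shows "(\<lambda>k. (1 / fact k) *\<^sub>R ((*v) A ^^ k) x) sums (mat_exp A *v x)"
proof -
  define \<theta> where "\<theta> = onorm ((*v) A)"
  have \<theta>: "0 \<le> \<theta>" "norm (A *v v) \<le> \<theta> * norm v" for v
    unfolding \<theta>_def by (auto intro!: onorm_pos_le onorm)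
  have "onorm ((*v) (mat_power A k)) \<le> \<theta> ^ k" for k
    by (rule onorm_bound) (use \<theta> in \<open>auto simp: mat_power_mult_vec intro!: norm_funpow_le\<close>)
  then have "norm (mat_power A k) \<le> real CARD('n) * (real CARD('n) * \<theta> ^ k)" for k
    by (intro order_trans[OF norm_matrix_le_onorm] mult_left_mono) auto
  then have "norm ((1 / fact k) *\<^sub>R mat_power A k) \<le> (real CARD('n) * real CARD('n)) * (inverse (fact k) * \<theta> ^ k)" for k
    by (simp add: divide_simps mult_ac)
  then have "summable (\<lambda>k. (1 / fact k) *\<^sub>R mat_power A k)"
    by (rule summable_comparison_test'[OF summable_mult[OF summable_exp], rotated])
  then have "(\<lambda>k. (1 / fact k) *\<^sub>R mat_power A k) sums mat_exp A"
    unfolding mat_exp_def by (rule summable_sums)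
  moreover have "bounded_linear (\<lambda>A :: real^'n^'n. A *v x)"
    unfolding linear_conv_bounded_linear[symmetric]
    by (rule linearI) (simp_all add: matrix_vector_mult_add_rdistrib scaleR_matrix_vector_assoc)
  ultimately have "(\<lambda>k. ((1 / fact k) *\<^sub>R mat_power A k) *v x) sums (mat_exp A *v x)"
    by (rule bounded_linear.sums[rotated])
  then show ?thesis by (simp add: mat_power_mult_vec flip: scaleR_matrix_vector_assoc)
qed

text \<open>Lowering the factorial of \<open>k + N\<close> to that of \<open>k\<close> leaves
  \<open>\<theta> ^ N\<close> times the series of \<open>exp \<theta>\<close>.\<close>

lemma mat_exp_taylor:
  fixes A :: "real^'n^'n"
  assumes A: "\<And>v. norm (A *v v) \<le> \<theta> * norm v" and \<theta>: "0 \<le> \<theta>"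
  shows "norm (mat_exp A *v x - (\<Sum>k<N. (1 / fact k) *\<^sub>R ((*v) A ^^ k) x)) \<le> \<theta> ^ N * exp \<theta> * norm x"
proof -
  let ?a = "\<lambda>k. (1 / fact k) *\<^sub>R ((*v) A ^^ k) x"
  let ?b = "\<lambda>k. \<theta> ^ N * norm x * (inverse (fact k) * \<theta> ^ k)"
  have s: "(\<lambda>k. ?a (k + N)) sums (mat_exp A *v x - (\<Sum>k<N. ?a k))"
    by (rule sums_split_initial_segment[OF mat_exp_sums])
  have b: "?b sums (\<theta> ^ N * norm x * exp \<theta>)"
    by (rule sums_mult) (use exp_converges[of \<theta>] in \<open>simp add: scaleR_conv_of_real\<close>)
  have le: "norm (?a (k + N)) \<le> ?b k" for k
  proof -
    have "norm (?a (k + N)) \<le> inverse (fact (k + N)) * (\<theta> ^ (k + N) * norm x)"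
      using norm_funpow_le[OF A \<theta>, of "k + N" x] by (simp add: divide_simps)
    also have "\<dots> \<le> inverse (fact k) * (\<theta> ^ (k + N) * norm x)"
      using \<theta> by (intro mult_right_mono le_imp_inverse_le fact_mono) auto
    finally show ?thesis by (simp add: power_add mult_ac)
  qed
  have "norm (\<Sum>k. ?a (k + N)) \<le> suminf ?b"
    by (rule norm_suminf_le[OF le sums_summable[OF b]])
  then show ?thesis using sums_unique[OF s] sums_unique[OF b] by (simp add: mult_ac)
qed

section \<open>Uniform bounds over families\<close>

text \<open>The Landau symbol O(w) with one constant on the whole index set instead of near a limit,
  so uniformity is carried along by every rule of the calculus.\<close>

definition dominated :: "'i set \<Rightarrow> ('i \<Rightarrow> 'a::real_normed_vector) \<Rightarrow> ('i \<Rightarrow> real) \<Rightarrow> bool" where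
  "dominated S F w \<longleftrightarrow> (\<exists>C\<ge>0. \<forall>i\<in>S. norm (F i) \<le> C * w i)"

lemma dominatedI:
  assumes "\<And>i. i \<in> S \<Longrightarrow> norm (F i) \<le> C * w i" "\<And>i. i \<in> S \<Longrightarrow> 0 \<le> w i"
  shows "dominated S F w"
  unfolding dominated_def
proof (intro exI[of _ "max 0 C"] conjI ballI)
  fix i assume i: "i \<in> S"
  have "C * w i \<le> max 0 C * w i" using assms(2)[OF i] by (intro mult_right_mono) auto
  then show "norm (F i) \<le> max 0 C * w i" using assms(1)[OF i] by linarith
qed simp

lemma dominatedE:
  assumes "dominated S F w"
  obtains C where "0 \<le> C" "\<And>i. i \<in> S \<Longrightarrow> norm (F i) \<le> C * w i"
  using assms unfolding dominated_def by blast

lemma dominated_norm: "dominated S (\<lambda>i. norm (F i)) w \<longleftrightarrow> dominated S F w"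
  unfolding dominated_def by simp

lemma dominated_zero: "dominated S (\<lambda>i. 0) w"
  unfolding dominated_def by (intro exI[of _ 0]) auto

lemma dominated_const: "dominated S (\<lambda>i. c) (\<lambda>i. 1)"
  unfolding dominated_def by (intro exI[of _ "norm c"]) auto

lemma dominated_add:
  assumes "dominated S F w" "dominated S G w"
  shows "dominated S (\<lambda>i. F i + G i) w"
proof -
  obtain C D where "0 \<le> C" "0 \<le> D" "\<And>i. i \<in> S \<Longrightarrow> norm (F i) \<le> C * w i" "\<And>i. i \<in> S \<Longrightarrow> norm (G i) \<le> D * w i"
    using assms unfolding dominated_def by blast
  moreover from this have "norm (F i + G i) \<le> (C + D) * w i" if "i \<in> S" for i
    using norm_triangle_ineq[of "F i" "G i"] that by (fastforce simp: distrib_right)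
  ultimately show ?thesis unfolding dominated_def by (intro exI[of _ "C + D"]) auto
qed

lemma dominated_minus: "dominated S F w \<Longrightarrow> dominated S (\<lambda>i. - F i) w"
  unfolding dominated_def by simp

lemma dominated_diff: "dominated S F w \<Longrightarrow> dominated S G w \<Longrightarrow> dominated S (\<lambda>i. F i - G i) w"
  using dominated_add[of S F w "\<lambda>i. - G i"] dominated_minus[of S G w] by simp

lemma dominated_le:
  assumes "\<And>i. i \<in> S \<Longrightarrow> norm (G i) \<le> B * w i * v i" "0 \<le> B"
    and "dominated S w w'" "dominated S v v'"
    and "\<And>i. i \<in> S \<Longrightarrow> 0 \<le> v i"
  shows "dominated S G (\<lambda>i. w' i * v' i)"
proof -
  obtain C D where C: "0 \<le> C" "\<And>i. i \<in> S \<Longrightarrow> norm (w i) \<le> C * w' i"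
    and D: "0 \<le> D" "\<And>i. i \<in> S \<Longrightarrow> norm (v i) \<le> D * v' i"
    using assms unfolding dominated_def by blast
  have "norm (G i) \<le> (B * C * D) * (w' i * v' i)" if i: "i \<in> S" for i
  proof -
    have G: "norm (G i) \<le> B * (w i * v i)" using assms(1)[OF i] by (simp add: mult_ac)
    have "w i * v i \<le> norm (w i) * norm (v i)" by (simp add: abs_mult[symmetric])
    also have "norm (w i) * norm (v i) \<le> (C * w' i) * (D * v' i)"
      by (intro mult_mono C D i) (use C(2)[OF i] norm_ge_zero order_trans in blast)+
    finally have "w i * v i \<le> (C * w' i) * (D * v' i)" .
    then have "B * (w i * v i) \<le> B * ((C * w' i) * (D * v' i))" using assms(2) by (rule mult_left_mono)
    then show ?thesis using G by (simp add: mult_ac)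
  qed
  then show ?thesis using C(1) D(1) assms(2) unfolding dominated_def by (intro exI[of _ "B * C * D"]) auto
qed

lemma dominated_mult:
  assumes "dominated S r w" "dominated S F w'"
  shows "dominated S (\<lambda>i. r i *\<^sub>R F i) (\<lambda>i. w i * w' i)"
  by (rule dominated_le[of S _ 1 "\<lambda>i. \<bar>r i\<bar>" "\<lambda>i. norm (F i)"])
    (use assms in \<open>auto simp: dominated_norm simp flip: real_norm_def\<close>)

lemma dominated_scaleR:
  assumes "dominated S r (\<lambda>i. 1)" "dominated S F w"
  shows "dominated S (\<lambda>i. r i *\<^sub>R F i) w"
  using dominated_mult[OF assms] by simp

lemma dominated_times:
  fixes r :: "'i \<Rightarrow> real"
  assumes "dominated S r (\<lambda>i. 1)" "dominated S F (\<lambda>i. 1)"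
  shows "dominated S (\<lambda>i. r i * F i) (\<lambda>i. 1)"
  using dominated_mult[OF assms] by simp

lemma dominated_trans:
  assumes "dominated S F w" "dominated S w w'"
  shows "dominated S F w'"
proof -
  obtain C D where C: "0 \<le> C" "\<And>i. i \<in> S \<Longrightarrow> norm (F i) \<le> C * w i"
    and D: "0 \<le> D" "\<And>i. i \<in> S \<Longrightarrow> norm (w i) \<le> D * w' i"
    using assms unfolding dominated_def by blast
  have "norm (F i) \<le> C * D * w' i" if i: "i \<in> S" for i
  proof -
    have "w i \<le> D * w' i" using D(2)[OF i] by simp
    then have "C * w i \<le> C * (D * w' i)" using C(1) by (rule mult_left_mono)
    then show ?thesis using C(2)[OF i] by (simp add: mult_ac)
  qed
  then show ?thesis using C(1) D(1) unfolding dominated_def by (intro exI[of _ "C * D"]) auto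
qed

lemma dominated_lipschitz:
  assumes "\<And>i. i \<in> S \<Longrightarrow> norm (G i) \<le> B * norm (F i)" "dominated S F w"
  shows "dominated S G w"
proof -
  have "dominated S G (\<lambda>i. norm (F i))" using assms(1) by (rule dominatedI) auto
  then show ?thesis by (rule dominated_trans) (simp add: dominated_norm assms)
qed

text \<open>The matrix varies with the index and only its norm \<open>\<mu>\<close> is common, while
  \<open>f\<close> is fixed. Constants obtained here therefore depend on the matrix through
  \<open>\<mu>\<close> alone.\<close>

locale semilinear_family =
  fixes S :: "'i set" and M :: "'i \<Rightarrow> real^'n^'n" and f :: "real^'n \<Rightarrow> real^'n"
    and h :: "'i \<Rightarrow> real" and \<mu> T :: real
  assumes smooth: "C_diff 4 f"
    and onorm_M: "i \<in> S \<Longrightarrow> onorm ((*v) (M i)) = \<mu>"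
    and h_nonneg: "i \<in> S \<Longrightarrow> 0 \<le> h i"
    and h_le: "i \<in> S \<Longrightarrow> h i \<le> T"
begin

abbreviation dom :: "('i \<Rightarrow> 'b::real_normed_vector) \<Rightarrow> ('i \<Rightarrow> real) \<Rightarrow> bool" where
  "dom \<equiv> dominated S"

lemma norm_M_le: "i \<in> S \<Longrightarrow> norm (M i *v x) \<le> \<mu> * norm x"
  using onorm[of "(*v) (M i)" x] onorm_M[of i] by simp

lemma mu_nonneg: "i \<in> S \<Longrightarrow> 0 \<le> \<mu>"
  using onorm_pos_le[of "(*v) (M i)"] onorm_M[of i] by simp

lemma dom_h: "dom h (\<lambda>i. 1)"
  by (rule dominatedI[of _ _ T]) (use h_nonneg h_le in auto)

lemma dom_h_power: "dom (\<lambda>i. h i ^ k) (\<lambda>i. 1)"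
  by (induction k) (auto intro: dominated_const dominated_times dom_h)

text \<open>Step sizes are at most \<open>T\<close>, so surplus powers of \<open>h\<close> are
  bounded factors.\<close>

lemma dom_h_mono:
  assumes "dom F (\<lambda>i. h i ^ k)" "j \<le> k"
  shows "dom F (\<lambda>i. h i ^ j)"
proof -
  have "dom (\<lambda>i. h i ^ (k - j) *\<^sub>R h i ^ j) (\<lambda>i. h i ^ j)"
    by (rule dominated_scaleR[OF dom_h_power]) (rule dominatedI[of _ _ 1], use h_nonneg in auto)
  moreover have "(\<lambda>i. h i ^ (k - j) *\<^sub>R h i ^ j) = (\<lambda>i. h i ^ k)"
    using assms(2) by (auto simp flip: power_add)
  ultimately have "dom (\<lambda>i. h i ^ k) (\<lambda>i. h i ^ j)" by metis
  then show ?thesis by (rule dominated_trans[OF assms(1)])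
qed

lemma dom_h_shift:
  assumes "dom F (\<lambda>i. h i ^ k)"
  shows "dom (\<lambda>i. h i ^ j *\<^sub>R F i) (\<lambda>i. h i ^ (j + k))"
proof -
  have "dom (\<lambda>i. h i ^ j) (\<lambda>i. h i ^ j)" by (rule dominatedI[of _ _ 1]) (use h_nonneg in auto)
  from dominated_mult[OF this assms] show ?thesis by (simp add: power_add)
qed

lemma dom_h_mult:
  assumes "dom F (\<lambda>i. 1)"
  shows "dom (\<lambda>i. h i ^ j *\<^sub>R F i) (\<lambda>i. h i ^ j)"
  using dom_h_shift[of F 0 j] assms by simp

lemma dom_M: "dom F w \<Longrightarrow> dom (\<lambda>i. M i *v F i) w"
  by (rule dominated_lipschitz[of _ _ \<mu>]) (use norm_M_le in auto)

lemma dom_f: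
  assumes "dom u (\<lambda>i. 1)"
  shows "dom (\<lambda>i. f (u i)) (\<lambda>i. 1)"
proof -
  obtain R where R: "\<And>i. i \<in> S \<Longrightarrow> norm (u i) \<le> R * 1" using assms dominatedE by blast
  obtain B where "\<And>x vs. norm x \<le> R \<Longrightarrow> length vs = 0 \<Longrightarrow> norm (ddirs vs f x) \<le> B * prod_list (map norm vs)"
    using ddirs_bounded[OF C_diff_mono[OF smooth, of 0]] by (metis le0)
  from this[of _ "[]"] show ?thesis using R by (intro dominatedI[of _ _ B]) auto
qed

lemma ddirs_bound:
  assumes "dom u (\<lambda>i. 1)" "k \<le> 4"
  obtains B where "0 \<le> B"
    "\<And>i vs. i \<in> S \<Longrightarrow> length vs = k \<Longrightarrow> norm (ddirs vs f (u i)) \<le> B * prod_list (map norm vs)"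
proof -
  obtain R where R: "\<And>i. i \<in> S \<Longrightarrow> norm (u i) \<le> R * 1" using assms dominatedE by blast
  obtain B where "0 \<le> B" "\<And>x vs. norm x \<le> R \<Longrightarrow> length vs = k \<Longrightarrow> norm (ddirs vs f x) \<le> B * prod_list (map norm vs)"
    using ddirs_bounded[OF C_diff_mono[OF smooth assms(2)], of R] by blast
  then show ?thesis using that[of B] R by auto
qed

lemma dom_deriv1:
  assumes "dom u (\<lambda>i. 1)" "dom x w"
  shows "dom (\<lambda>i. ddirs [x i] f (u i)) w"
proof -
  obtain B where "\<And>i vs. i \<in> S \<Longrightarrow> length vs = 1 \<Longrightarrow> norm (ddirs vs f (u i)) \<le> B * prod_list (map norm vs)"
    by (rule ddirs_bound[OF assms(1), of 1]) auto
  from this[of _ "[_]"] show ?thesis by (intro dominated_lipschitz[OF _ assms(2), of _ B]) auto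
qed

text \<open>The weights are general because two uses differ: powers of \<open>h\<close> in the
  expansions, and \<open>norm (u i - v i)\<close> in the Lipschitz estimate.\<close>

lemma dom_deriv2_mult:
  assumes "dom u (\<lambda>i. 1)" "dom x w" "dom y v"
  shows "dom (\<lambda>i. ddirs [x i, y i] f (u i)) (\<lambda>i. w i * v i)"
proof -
  obtain B where B: "0 \<le> B" "\<And>i vs. i \<in> S \<Longrightarrow> length vs = 2 \<Longrightarrow> norm (ddirs vs f (u i)) \<le> B * prod_list (map norm vs)"
    by (rule ddirs_bound[OF assms(1), of 2]) auto
  from B(2)[of _ "[_, _]"] show ?thesis
    by (intro dominated_le[OF _ B(1), of _ _ "\<lambda>i. norm (x i)" "\<lambda>i. norm (y i)"])
      (use assms in \<open>auto simp: dominated_norm mult_ac\<close>)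
qed

lemma dom_deriv3_mult:
  assumes "dom u (\<lambda>i. 1)" "dom x w" "dom y v" "dom z t"
  shows "dom (\<lambda>i. ddirs [x i, y i, z i] f (u i)) (\<lambda>i. w i * (v i * t i))"
proof -
  obtain B where B: "0 \<le> B" "\<And>i vs. i \<in> S \<Longrightarrow> length vs = 3 \<Longrightarrow> norm (ddirs vs f (u i)) \<le> B * prod_list (map norm vs)"
    by (rule ddirs_bound[OF assms(1), of 3]) auto
  have "dom (\<lambda>i. norm (y i) *\<^sub>R norm (z i)) (\<lambda>i. v i * t i)"
    by (rule dominated_mult) (use assms in \<open>auto simp: dominated_norm\<close>)
  with B(2)[of _ "[_, _, _]"] show ?thesis
    by (intro dominated_le[of S _ B "\<lambda>i. norm (x i)" "\<lambda>i. norm (y i) * norm (z i)" w "\<lambda>i. v i * t i"])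
      (use assms B(1) in \<open>simp_all add: dominated_norm mult.assoc\<close>)
qed

lemma dom_deriv2:
  assumes "dom u (\<lambda>i. 1)" "dom x (\<lambda>i. h i ^ j)" "dom y (\<lambda>i. h i ^ k)"
  shows "dom (\<lambda>i. ddirs [x i, y i] f (u i)) (\<lambda>i. h i ^ (j + k))"
  using dom_deriv2_mult[OF assms] by (simp add: power_add)

lemma dom_deriv3:
  assumes "dom u (\<lambda>i. 1)" "dom x (\<lambda>i. h i ^ j)" "dom y (\<lambda>i. h i ^ k)" "dom z (\<lambda>i. h i ^ l)"
  shows "dom (\<lambda>i. ddirs [x i, y i, z i] f (u i)) (\<lambda>i. h i ^ (j + k + l))"
  using dom_deriv3_mult[OF assms] by (simp add: power_add mult_ac)

lemma dom_taylor:
  assumes "dom u (\<lambda>i. 1)" "dom d h"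
  shows "dom (\<lambda>i. f (u i + d i) - (f (u i) + ddirs [d i] f (u i) + (1/2) *\<^sub>R ddirs [d i, d i] f (u i)
           + (1/6) *\<^sub>R ddirs [d i, d i, d i] f (u i))) (\<lambda>i. h i ^ 4)"
proof -
  obtain R where R: "\<And>i. i \<in> S \<Longrightarrow> norm (u i) \<le> R * 1" using assms dominatedE by blast
  have "dom d (\<lambda>i. 1)" using dominated_trans[OF assms(2) dom_h] .
  then obtain D where D: "\<And>i. i \<in> S \<Longrightarrow> norm (d i) \<le> D * 1" using dominatedE by blast
  obtain B where B: "0 \<le> B" "\<And>u d. norm u \<le> max R D \<Longrightarrow> norm d \<le> max R D \<Longrightarrow>
      norm (f (u + d) - (f u + ddirs [d] f u + (1/2) *\<^sub>R ddirs [d, d] f u + (1/6) *\<^sub>R ddirs [d, d, d] f u))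
        \<le> B * norm d ^ 4"
    using ddirs_taylor[of 4 "[]" f "max R D"] smooth
    by (auto simp: eval_nat_numeral fact_reduce add_ac simp del: C_diff.simps)
  obtain C where C: "0 \<le> C" "\<And>i. i \<in> S \<Longrightarrow> norm (d i) \<le> C * h i" using assms(2) dominatedE by blast
  show ?thesis
  proof (rule dominatedI[of _ _ "B * C ^ 4"])
    fix i assume i: "i \<in> S"
    have "norm (d i) ^ 4 \<le> (C * h i) ^ 4" by (intro power_mono C i) auto
    then have "B * norm (d i) ^ 4 \<le> B * C ^ 4 * h i ^ 4"
      using B(1) by (simp add: power_mult_distrib mult_left_mono mult.assoc)
    moreover have "norm (u i) \<le> max R D" "norm (d i) \<le> max R D" using R[OF i] D[OF i] by auto
    ultimately show "norm (f (u i + d i) - (f (u i) + ddirs [d i] f (u i) + (1/2) *\<^sub>R ddirs [d i, d i] f (u i)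
           + (1/6) *\<^sub>R ddirs [d i, d i, d i] f (u i))) \<le> B * C ^ 4 * h i ^ 4"
      using B(2) order_trans by blast
  qed (use h_nonneg in auto)
qed

lemma linear_deriv:
  "linear (\<lambda>x. ddirs [x] f p)"
  "linear (\<lambda>x. ddirs [x, y] f p)" "linear (\<lambda>x. ddirs [y, x] f p)"
  "linear (\<lambda>x. ddirs [x, y, z] f p)" "linear (\<lambda>x. ddirs [y, x, z] f p)" "linear (\<lambda>x. ddirs [y, z, x] f p)"
  using linear_ddirs[of "[]" "[]" f p] linear_ddirs[of "[]" "[y]" f p] linear_ddirs[of "[y]" "[]" f p]
    linear_ddirs[of "[]" "[y, z]" f p] linear_ddirs[of "[y]" "[z]" f p] linear_ddirs[of "[y, z]" "[]" f p]
    C_diff_mono[OF smooth, of 1] C_diff_mono[OF smooth, of 2] C_diff_mono[OF smooth, of 3]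
  by (simp_all add: eval_nat_numeral del: C_diff.simps)

lemma deriv2_commute: "ddirs [x, y] f p = ddirs [y, x] f p"
  by (rule second_deriv_symmetric) (rule C_diff_mono[OF smooth], simp)

end

section \<open>Expansions in the step size\<close>

locale point_family = semilinear_family S M f h \<mu> T
  for S :: "'i set" and M :: "'i \<Rightarrow> real^'n^'n" and f :: "real^'n \<Rightarrow> real^'n"
    and h :: "'i \<Rightarrow> real" and \<mu> T :: real +
  fixes u :: "'i \<Rightarrow> real^'n"
  assumes dom_u: "dominated S u (\<lambda>i. 1)"
begin

text \<open>These names hide the matrix product and the derivatives of \<open>f\<close>, so that
  simplification sees symbols linear in each argument and expansions become polynomial
  algebra.\<close>

definition m :: "'i \<Rightarrow> real^'n \<Rightarrow> real^'n" where "m i x = M i *v x"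
definition J :: "'i \<Rightarrow> real^'n \<Rightarrow> real^'n" where "J i x = ddirs [x] f (u i)"
definition H :: "'i \<Rightarrow> real^'n \<Rightarrow> real^'n \<Rightarrow> real^'n" where "H i x y = ddirs [x, y] f (u i)"
definition K :: "'i \<Rightarrow> real^'n \<Rightarrow> real^'n \<Rightarrow> real^'n \<Rightarrow> real^'n" where
  "K i x y z = ddirs [x, y, z] f (u i)"
definition F :: "'i \<Rightarrow> real^'n" where "F i = f (u i)"
definition g :: "'i \<Rightarrow> real^'n" where "g i = - m i (u i) + F i"

lemma lin: "linear (m i)" "linear (J i)" "linear (\<lambda>x. H i x y)" "linear (H i x)"
  "linear (\<lambda>x. K i x y z)" "linear (\<lambda>y. K i x y z)" "linear (K i x y)"
  using linear_deriv unfolding J_def[abs_def] H_def[abs_def] K_def[abs_def] m_def[abs_def] by auto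

lemmas lin_simps =
  lin[THEN linear_add] lin[THEN linear_diff] lin[THEN linear_scale] lin[THEN linear_neg]

lemma dom_J: "dom x w \<Longrightarrow> dom (\<lambda>i. J i (x i)) w"
  unfolding J_def by (rule dom_deriv1[OF dom_u])

lemma dom_m: "dom x w \<Longrightarrow> dom (\<lambda>i. m i (x i)) w"
  unfolding m_def by (rule dom_M)

lemma dom_H: "dom x (\<lambda>i. h i ^ j) \<Longrightarrow> dom y (\<lambda>i. h i ^ k) \<Longrightarrow> dom (\<lambda>i. H i (x i) (y i)) (\<lambda>i. h i ^ (j + k))"
  unfolding H_def by (rule dom_deriv2[OF dom_u])

lemma dom_K: "dom x (\<lambda>i. h i ^ j) \<Longrightarrow> dom y (\<lambda>i. h i ^ k) \<Longrightarrow> dom z (\<lambda>i. h i ^ l)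
    \<Longrightarrow> dom (\<lambda>i. K i (x i) (y i) (z i)) (\<lambda>i. h i ^ (j + k + l))"
  unfolding K_def by (rule dom_deriv3[OF dom_u])

lemma dom_H_bounded: "dom x (\<lambda>i. 1) \<Longrightarrow> dom y (\<lambda>i. 1) \<Longrightarrow> dom (\<lambda>i. H i (x i) (y i)) (\<lambda>i. 1)"
  using dom_H[of x 0 y 0] by simp

lemma dom_K_bounded: "dom x (\<lambda>i. 1) \<Longrightarrow> dom y (\<lambda>i. 1) \<Longrightarrow> dom z (\<lambda>i. 1)
    \<Longrightarrow> dom (\<lambda>i. K i (x i) (y i) (z i)) (\<lambda>i. 1)"
  using dom_K[of x 0 y 0 z 0] by simp

lemma dom_F: "dom F (\<lambda>i. 1)"
  unfolding F_def[abs_def] by (rule dom_f[OF dom_u])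

lemma dom_g: "dom g (\<lambda>i. 1)"
  unfolding g_def[abs_def] by (intro dominated_add dominated_minus dom_m dom_u dom_F)

lemmas bounded_intros = dominated_add dominated_diff dominated_minus dominated_scaleR[OF dominated_const]
  dom_J dom_m dom_H_bounded dom_K_bounded dom_F dom_g dom_u

text \<open>A truncated power series in \<open>h\<close> is substituted into the cubic Taylor
  polynomial of \<open>f\<close>. The exact flow and all internal stages are instances.\<close>

lemma taylor_expansion:
  assumes d1: "dom d1 (\<lambda>i. 1)" and d2: "dom d2 (\<lambda>i. 1)" and d3: "dom d3 (\<lambda>i. 1)"
    and r: "dom (\<lambda>i. d i - (h i *\<^sub>R d1 i + h i ^ 2 *\<^sub>R d2 i + h i ^ 3 *\<^sub>R d3 i)) (\<lambda>i. h i ^ 4)"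
  shows "dom (\<lambda>i. f (u i + d i) -
      (F i + h i *\<^sub>R J i (d1 i) + h i ^ 2 *\<^sub>R (J i (d2 i) + (1/2) *\<^sub>R H i (d1 i) (d1 i))
       + h i ^ 3 *\<^sub>R (J i (d3 i) + H i (d1 i) (d2 i) + (1/6) *\<^sub>R K i (d1 i) (d1 i) (d1 i)))) (\<lambda>i. h i ^ 4)"
proof -
  \<comment> \<open>\<open>r1\<close>, \<open>r2\<close> and \<open>r0\<close> are what remains of
    \<open>d\<close> after its terms of order one, two and three.\<close>
  define r0 where "r0 i = d i - (h i *\<^sub>R d1 i + h i ^ 2 *\<^sub>R d2 i + h i ^ 3 *\<^sub>R d3 i)" for i
  define e where "e i = h i *\<^sub>R d1 i + h i ^ 2 *\<^sub>R d2 i" for i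
  define r2 where "r2 i = h i ^ 3 *\<^sub>R d3 i + r0 i" for i
  define r1 where "r1 i = h i ^ 2 *\<^sub>R d2 i + r2 i" for i
  have R0: "dom r0 (\<lambda>i. h i ^ 4)" using r by (simp add: r0_def[abs_def])
  have R2: "dom r2 (\<lambda>i. h i ^ 3)"
    unfolding r2_def[abs_def] by (intro dominated_add dom_h_mult d3 dom_h_mono[OF R0]) simp
  have R1: "dom r1 (\<lambda>i. h i ^ 2)"
    unfolding r1_def[abs_def] by (intro dominated_add dom_h_mult d2 dom_h_mono[OF R2]) simp
  have hd1: "dom (\<lambda>i. h i *\<^sub>R d1 i) (\<lambda>i. h i ^ 1)" using dom_h_mult[OF d1, of 1] by simp
  have E: "dom e (\<lambda>i. h i ^ 1)"
    unfolding e_def[abs_def] by (intro dominated_add hd1 dom_h_mono[OF dom_h_mult[OF d2]]) simp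
  have d: "d i = e i + r2 i" "d i = h i *\<^sub>R d1 i + r1 i" for i
    by (simp_all add: e_def r2_def r1_def r0_def)
  have D: "dom d (\<lambda>i. h i ^ 1)"
    unfolding d(1)[abs_def] by (intro dominated_add E dom_h_mono[OF R2]) simp
  \<comment> \<open>Symmetry of the second derivative merges the two mixed terms; the last bracket
    is of order \<open>h ^ 4\<close>.\<close>
  have Hd: "H i (d i) (d i) = h i ^ 2 *\<^sub>R H i (d1 i) (d1 i) + (2 * h i ^ 3) *\<^sub>R H i (d1 i) (d2 i)
      + (h i ^ 4 *\<^sub>R H i (d2 i) (d2 i) + H i (r2 i) (d i) + H i (e i) (r2 i))" for i
  proof -
    have "H i (d2 i) (d1 i) = H i (d1 i) (d2 i)" unfolding H_def by (rule deriv2_commute)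
    then show ?thesis
      unfolding d(1) by (simp add: lin_simps e_def) (simp add: vec_eq_iff algebra_simps eval_nat_numeral)
  qed
  \<comment> \<open>Telescoping one slot at a time leaves in every error term a factor
    \<open>r1\<close> of order \<open>h ^ 2\<close> beside two arguments of order
    \<open>h\<close>.\<close>
  have Kd: "K i (d i) (d i) (d i) = h i ^ 3 *\<^sub>R K i (d1 i) (d1 i) (d1 i)
      + (K i (r1 i) (d i) (d i) + K i (h i *\<^sub>R d1 i) (r1 i) (d i) + K i (h i *\<^sub>R d1 i) (h i *\<^sub>R d1 i) (r1 i))" for i
    unfolding d(2) by (simp add: lin_simps algebra_simps eval_nat_numeral)
  have Jd: "J i (d i) = h i *\<^sub>R J i (d1 i) + h i ^ 2 *\<^sub>R J i (d2 i) + h i ^ 3 *\<^sub>R J i (d3 i) + J i (r0 i)" for i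
    unfolding d(1) by (simp add: lin_simps e_def r2_def algebra_simps)
  define q where "q i = f (u i + d i) - (F i + J i (d i) + (1/2) *\<^sub>R H i (d i) (d i) + (1/6) *\<^sub>R K i (d i) (d i) (d i))" for i
  have Q: "dom q (\<lambda>i. h i ^ 4)"
    unfolding q_def[abs_def] F_def J_def H_def K_def by (rule dom_taylor[OF dom_u]) (use D in simp)
  have *: "f (u i + d i) -
      (F i + h i *\<^sub>R J i (d1 i) + h i ^ 2 *\<^sub>R (J i (d2 i) + (1/2) *\<^sub>R H i (d1 i) (d1 i))
       + h i ^ 3 *\<^sub>R (J i (d3 i) + H i (d1 i) (d2 i) + (1/6) *\<^sub>R K i (d1 i) (d1 i) (d1 i)))
    = q i + J i (r0 i) + (1/2) *\<^sub>R (h i ^ 4 *\<^sub>R H i (d2 i) (d2 i) + H i (r2 i) (d i) + H i (e i) (r2 i))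
      + (1/6) *\<^sub>R (K i (r1 i) (d i) (d i) + K i (h i *\<^sub>R d1 i) (r1 i) (d i) + K i (h i *\<^sub>R d1 i) (h i *\<^sub>R d1 i) (r1 i))" for i
    unfolding q_def Hd Kd Jd by (simp add: algebra_simps)
  have k: "dom (\<lambda>i. H i (r2 i) (d i)) (\<lambda>i. h i ^ 4)" "dom (\<lambda>i. H i (e i) (r2 i)) (\<lambda>i. h i ^ 4)"
    "dom (\<lambda>i. K i (r1 i) (d i) (d i)) (\<lambda>i. h i ^ 4)"
    "dom (\<lambda>i. K i (h i *\<^sub>R d1 i) (r1 i) (d i)) (\<lambda>i. h i ^ 4)"
    "dom (\<lambda>i. K i (h i *\<^sub>R d1 i) (h i *\<^sub>R d1 i) (r1 i)) (\<lambda>i. h i ^ 4)"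
    using dom_H[OF R2 D] dom_H[OF E R2] dom_K[OF R1 D D] dom_K[OF hd1 R1 D] dom_K[OF hd1 hd1 R1]
    by (simp_all del: power_one_right add: numeral_eq_Suc)
  show ?thesis
    unfolding * by (intro dominated_add Q dom_J R0 k dominated_scaleR[OF dominated_const] dom_h_mult
        dom_H_bounded d2)
qed

subsection \<open>Expansion of the exact flow\<close>

text \<open>\<open>flow2\<close>, \<open>flow3\<close> and \<open>flow4\<close> are the formal
  second to fourth time derivatives at \<open>u\<close>: the differential equation is differentiated
  repeatedly and the first derivative replaced by \<open>g\<close>. The factor 3 in
  \<open>flow4\<close> is 2 from differentiating the arguments of the second derivative of
  \<open>f\<close>, plus 1 from differentiating its Jacobian.\<close>

definition flow2 :: "'i \<Rightarrow> real^'n" where "flow2 i = - m i (g i) + J i (g i)"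
definition flow3 :: "'i \<Rightarrow> real^'n" where
  "flow3 i = H i (g i) (g i) - m i (flow2 i) + J i (flow2 i)"
definition flow4 :: "'i \<Rightarrow> real^'n" where
  "flow4 i = K i (g i) (g i) (g i) + 3 *\<^sub>R H i (g i) (flow2 i) - m i (flow3 i) + J i (flow3 i)"

definition flow :: "'i \<Rightarrow> real \<Rightarrow> real^'n" where
  "flow i s = u i + s *\<^sub>R g i + (s ^ 2 / 2) *\<^sub>R flow2 i + (s ^ 3 / 6) *\<^sub>R flow3 i + (s ^ 4 / 24) *\<^sub>R flow4 i"
definition flow' :: "'i \<Rightarrow> real \<Rightarrow> real^'n" where
  "flow' i s = g i + s *\<^sub>R flow2 i + (s ^ 2 / 2) *\<^sub>R flow3 i + (s ^ 3 / 6) *\<^sub>R flow4 i"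

lemma dom_flow_coeffs:
  "dom flow2 (\<lambda>i. 1)" "dom flow3 (\<lambda>i. 1)" "dom flow4 (\<lambda>i. 1)"
proof -
  show 2: "dom flow2 (\<lambda>i. 1)" unfolding flow2_def[abs_def] by (intro bounded_intros)
  show 3: "dom flow3 (\<lambda>i. 1)" unfolding flow3_def[abs_def] by (intro bounded_intros 2)
  show "dom flow4 (\<lambda>i. 1)" unfolding flow4_def[abs_def] by (intro bounded_intros 2 3)
qed

text \<open>The recursion for the flow coefficients cancels the orders \<open>h ^ 0\<close> to
  \<open>h ^ 3\<close>. There remain the Taylor remainder of \<open>f\<close> and \<open>M\<close>
  applied to the quartic term.\<close>

lemma flow_residual:
  "dom (\<lambda>i. flow' i (h i) - (- m i (flow i (h i)) + f (flow i (h i)))) (\<lambda>i. h i ^ 4)"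
proof -
  define d where "d i = flow i (h i) - u i" for i
  have r: "d i - (h i *\<^sub>R g i + h i ^ 2 *\<^sub>R ((1/2) *\<^sub>R flow2 i) + h i ^ 3 *\<^sub>R ((1/6) *\<^sub>R flow3 i))
      = h i ^ 4 *\<^sub>R (1/24) *\<^sub>R flow4 i" for i
    by (simp add: d_def flow_def algebra_simps)
  have t: "dom (\<lambda>i. f (u i + d i) -
      (F i + h i *\<^sub>R J i (g i) + h i ^ 2 *\<^sub>R (J i ((1/2) *\<^sub>R flow2 i) + (1/2) *\<^sub>R H i (g i) (g i))
       + h i ^ 3 *\<^sub>R (J i ((1/6) *\<^sub>R flow3 i) + H i (g i) ((1/2) *\<^sub>R flow2 i)
           + (1/6) *\<^sub>R K i (g i) (g i) (g i)))) (\<lambda>i. h i ^ 4)" (is "dom ?q _")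
    by (rule taylor_expansion; (simp only: r)?; intro bounded_intros dom_flow_coeffs dom_h_mult)
  have "flow' i (h i) - (- m i (flow i (h i)) + f (flow i (h i))) = h i ^ 4 *\<^sub>R m i ((1/24) *\<^sub>R flow4 i) - ?q i" for i
  proof -
    have "flow i (h i) = u i + d i" by (simp add: d_def)
    then have "f (flow i (h i)) = f (u i + d i)" by simp
    \<comment> \<open>Each definition is solved for its highest derivative of \<open>f\<close>,
      which turns the expansion of \<open>f\<close> into flow coefficients.\<close>
    moreover have "F i = g i + m i (u i)" by (simp add: g_def)
    moreover have "J i (g i) = flow2 i + m i (g i)" by (simp add: flow2_def)
    moreover have "H i (g i) (g i) = flow3 i + m i (flow2 i) - J i (flow2 i)" by (simp add: flow3_def)
    moreover have "K i (g i) (g i) (g i) = flow4 i + m i (flow3 i) - J i (flow3 i) - 3 *\<^sub>R H i (g i) (flow2 i)"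
      by (simp add: flow4_def)
    ultimately show ?thesis
      by (simp add: flow_def flow'_def lin_simps) (simp add: algebra_simps flip: scaleR_add_left)
  qed
  then show ?thesis
    by (simp only:) (intro dominated_diff t dom_h_mult bounded_intros dom_flow_coeffs)
qed

end

section \<open>The exponential of the scaled matrix\<close>

context semilinear_family
begin

definition E :: "real \<Rightarrow> 'i \<Rightarrow> real^'n \<Rightarrow> real^'n" where
  "E c i x = mat_exp (- (c * h i) *\<^sub>R M i) *v x"

lemma funpow_scaled:
  fixes A :: "real^'k^'k"
  shows "((*v) (r *\<^sub>R A) ^^ k) x = r ^ k *\<^sub>R ((*v) A ^^ k) x"
  by (induction k) (simp_all add: matrix_vector_mult_scaleR scaleR_matrix_vector_assoc[symmetric])

text \<open>The weight \<open>w\<close> is \<open>1\<close> for expansions at a point and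
  \<open>norm (u i - v i)\<close> for the dependence on the starting point. For \<open>N = 0\<close>
  the sum is empty and plain boundedness results.\<close>

lemma dom_E_taylor:
  assumes x: "dom x w" and w: "\<And>i. i \<in> S \<Longrightarrow> 0 \<le> w i"
  shows "dom (\<lambda>i. E c i (x i) - (\<Sum>k<N. ((- (c * h i)) ^ k / fact k) *\<^sub>R ((*v) (M i) ^^ k) (x i))) (\<lambda>i. h i ^ N * w i)"
proof -
  \<comment> \<open>The exponential factor of the remainder is frozen at the largest step size
    \<open>T\<close>.\<close>
  define B where "B = (\<bar>c\<bar> * \<mu>) ^ N * exp (\<bar>c\<bar> * T * \<mu>)"
  have "norm (E c i (x i) - (\<Sum>k<N. ((- (c * h i)) ^ k / fact k) *\<^sub>R ((*v) (M i) ^^ k) (x i)))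
      \<le> B * norm (h i ^ N *\<^sub>R x i)" if i: "i \<in> S" for i
  proof -
    let ?\<theta> = "\<bar>c\<bar> * h i * \<mu>"
    have "norm ((- (c * h i) *\<^sub>R M i) *v v) \<le> ?\<theta> * norm v" for v
      using mult_left_mono[OF norm_M_le[OF i, of v], of "\<bar>c\<bar> * h i"] h_nonneg[OF i]
      unfolding scaleR_matrix_vector_assoc[symmetric] by (simp add: abs_mult mult_ac)
    then have "norm (E c i (x i) - (\<Sum>k<N. (1 / fact k) *\<^sub>R ((*v) (- (c * h i) *\<^sub>R M i) ^^ k) (x i)))
        \<le> ?\<theta> ^ N * exp ?\<theta> * norm (x i)"
      unfolding E_def by (rule mat_exp_taylor) (use h_nonneg[OF i] mu_nonneg[OF i] in auto)
    also have "\<dots> \<le> ?\<theta> ^ N * exp (\<bar>c\<bar> * T * \<mu>) * norm (x i)"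
      using h_nonneg[OF i] mu_nonneg[OF i] h_le[OF i]
      by (intro mult_right_mono mult_left_mono) (auto intro!: mult_mono)
    also have "\<dots> = B * norm (h i ^ N *\<^sub>R x i)"
      using h_nonneg[OF i] by (simp add: B_def power_mult_distrib mult_ac)
    finally show ?thesis unfolding funpow_scaled by simp
  qed
  moreover have "dom (\<lambda>i. h i ^ N) (\<lambda>i. h i ^ N)"
    by (rule dominatedI[of _ _ 1]) (use h_nonneg in auto)
  ultimately show ?thesis
    by (intro dominated_lipschitz[OF _ dominated_mult[OF _ x]])
qed

lemma dom_E:
  assumes "dom x w" and w: "\<And>i. i \<in> S \<Longrightarrow> 0 \<le> w i"
  shows "dom (\<lambda>i. E c i (x i)) w"
  using dom_E_taylor[OF assms, of c 0] by simp

end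

section \<open>The internal stages\<close>

context point_family
begin

definition incr :: "real \<Rightarrow> real \<Rightarrow> real \<Rightarrow> real \<Rightarrow> 'i \<Rightarrow> real^'n" where
  "incr c e q s i = h i *\<^sub>R c *\<^sub>R g i + h i ^ 2 *\<^sub>R ((c ^ 2 / 2) *\<^sub>R m i (m i (u i)) + e *\<^sub>R J i (g i))
     + h i ^ 3 *\<^sub>R (- (c ^ 3 / 6) *\<^sub>R m i (m i (m i (u i)))
         + (q / 2) *\<^sub>R (J i (m i (m i (u i))) + H i (g i) (g i)) + s *\<^sub>R J i (J i (g i)))"

text \<open>For a stage with \<open>c = \<Sum>\<^sub>j a\<^sub>i\<^sub>j\<close>, \<open>e = \<Sum>\<^sub>j a\<^sub>i\<^sub>j c\<^sub>j\<close>, \<open>q = \<Sum>\<^sub>j a\<^sub>i\<^sub>j c\<^sub>j\<^sup>2\<close> and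
  \<open>s = \<Sum>\<^sub>j a\<^sub>i\<^sub>j e\<^sub>j\<close>, \<open>u + incr c e q s\<close> is the argument of \<open>f\<close> and \<open>stage c e q s\<close> its
  value, both modulo \<open>O(h\<^sup>4)\<close>.\<close>

definition stage :: "real \<Rightarrow> real \<Rightarrow> real \<Rightarrow> real \<Rightarrow> 'i \<Rightarrow> real^'n" where
  "stage c e q s i = F i + h i *\<^sub>R c *\<^sub>R J i (g i)
     + h i ^ 2 *\<^sub>R (c ^ 2 *\<^sub>R (1/2) *\<^sub>R (J i (m i (m i (u i))) + H i (g i) (g i)) + e *\<^sub>R J i (J i (g i)))
     + h i ^ 3 *\<^sub>R (c ^ 3 *\<^sub>R ((1/2) *\<^sub>R H i (g i) (m i (m i (u i))) - (1/6) *\<^sub>R J i (m i (m i (m i (u i))))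
            + (1/6) *\<^sub>R K i (g i) (g i) (g i))
         + q *\<^sub>R (1/2) *\<^sub>R J i (J i (m i (m i (u i))) + H i (g i) (g i)) + s *\<^sub>R J i (J i (J i (g i)))
         + (c * e) *\<^sub>R H i (g i) (J i (g i)))"

lemma stage_expansion:
  assumes "dom (\<lambda>i. d i - incr c e q s i) (\<lambda>i. h i ^ 4)"
  shows "dom (\<lambda>i. f (u i + d i) - stage c e q s i) (\<lambda>i. h i ^ 4)"
proof -
  define d1 where "d1 i = c *\<^sub>R g i" for i
  define d2 where "d2 i = (c ^ 2 / 2) *\<^sub>R m i (m i (u i)) + e *\<^sub>R J i (g i)" for i
  define d3 where "d3 i = - (c ^ 3 / 6) *\<^sub>R m i (m i (m i (u i)))
         + (q / 2) *\<^sub>R (J i (m i (m i (u i))) + H i (g i) (g i)) + s *\<^sub>R J i (J i (g i))" for i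
  have "incr c e q s i = h i *\<^sub>R d1 i + h i ^ 2 *\<^sub>R d2 i + h i ^ 3 *\<^sub>R d3 i" for i
    by (simp add: incr_def d1_def d2_def d3_def)
  then have r: "dom (\<lambda>i. d i - (h i *\<^sub>R d1 i + h i ^ 2 *\<^sub>R d2 i + h i ^ 3 *\<^sub>R d3 i)) (\<lambda>i. h i ^ 4)"
    using assms by simp
  have b: "dom d1 (\<lambda>i. 1)" "dom d2 (\<lambda>i. 1)" "dom d3 (\<lambda>i. 1)"
    unfolding d1_def[abs_def] d2_def[abs_def] d3_def[abs_def] by (intro bounded_intros)+
  have "F i + h i *\<^sub>R J i (d1 i) + h i ^ 2 *\<^sub>R (J i (d2 i) + (1/2) *\<^sub>R H i (d1 i) (d1 i))
       + h i ^ 3 *\<^sub>R (J i (d3 i) + H i (d1 i) (d2 i) + (1/6) *\<^sub>R K i (d1 i) (d1 i) (d1 i)) = stage c e q s i" for i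
    unfolding d1_def d2_def d3_def stage_def lin_simps
    by (simp add: vec_eq_iff) (simp add: algebra_simps eval_nat_numeral)
  with taylor_expansion[OF b r] show ?thesis by simp
qed

text \<open>One statement serves stages two to four, an absent predecessor having coefficient 0. The
  condition on \<open>c\<close> is what combines the linear term of the exponential with the leading
  part of the stage sum into \<open>h i *\<^sub>R c *\<^sub>R g i\<close>.\<close>

lemma incr_expansion:
  assumes k: "dom (\<lambda>i. k2 i - stage c2 0 0 0 i) (\<lambda>i. h i ^ 4)" "dom (\<lambda>i. k3 i - stage c3 e3 q3 0 i) (\<lambda>i. h i ^ 4)"
    and c: "c = a1 + a2 + a3"
  shows "dom (\<lambda>i. (E c i (u i) + h i *\<^sub>R (a1 *\<^sub>R F i + a2 *\<^sub>R k2 i + a3 *\<^sub>R k3 i)) - u i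
      - incr c (a2 * c2 + a3 * c3) (a2 * c2\<^sup>2 + a3 * c3\<^sup>2) (a3 * e3) i) (\<lambda>i. h i ^ 4)"
proof -
  \<comment> \<open>The coefficient of \<open>h ^ 3\<close> in \<open>stage\<close>; the factor
    \<open>h\<close> before the stage sum moves it into the remainder.\<close>
  define p where "p c e q s i = c ^ 3 *\<^sub>R ((1/2) *\<^sub>R H i (g i) (m i (m i (u i))) - (1/6) *\<^sub>R J i (m i (m i (m i (u i))))
            + (1/6) *\<^sub>R K i (g i) (g i) (g i))
         + q *\<^sub>R (1/2) *\<^sub>R J i (J i (m i (m i (u i))) + H i (g i) (g i)) + s *\<^sub>R J i (J i (J i (g i)))
         + (c * e) *\<^sub>R H i (g i) (J i (g i))" for c e q s i
  have P: "dom (\<lambda>i. p c e q s i) (\<lambda>i. 1)" for c e q s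
    unfolding p_def by (intro bounded_intros)
  have st: "stage c e q s i = F i + h i *\<^sub>R c *\<^sub>R J i (g i)
     + h i ^ 2 *\<^sub>R (c ^ 2 *\<^sub>R (1/2) *\<^sub>R (J i (m i (m i (u i))) + H i (g i) (g i)) + e *\<^sub>R J i (J i (g i)))
     + h i ^ 3 *\<^sub>R p c e q s i" for c e q s i
    by (simp add: stage_def p_def)
  have k1: "dom (\<lambda>i. k2 i - stage c2 0 0 0 i) (\<lambda>i. h i ^ 3)" "dom (\<lambda>i. k3 i - stage c3 e3 q3 0 i) (\<lambda>i. h i ^ 3)"
    by (rule k[THEN dom_h_mono], simp)+
  have t: "dom (\<lambda>i. E c i (u i) - (u i - (c * h i) *\<^sub>R m i (u i) + ((c * h i)\<^sup>2 / 2) *\<^sub>R m i (m i (u i))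
        - ((c * h i) ^ 3 / 6) *\<^sub>R m i (m i (m i (u i))))) (\<lambda>i. h i ^ 4)"
    using dom_E_taylor[OF dom_u, of c 4] by (simp add: eval_nat_numeral fact_reduce m_def algebra_simps)
  have id: "(E c i (u i) + h i *\<^sub>R (a1 *\<^sub>R F i + a2 *\<^sub>R k2 i + a3 *\<^sub>R k3 i)) - u i
      - incr c (a2 * c2 + a3 * c3) (a2 * c2\<^sup>2 + a3 * c3\<^sup>2) (a3 * e3) i
    = (E c i (u i) - (u i - (c * h i) *\<^sub>R m i (u i) + ((c * h i)\<^sup>2 / 2) *\<^sub>R m i (m i (u i))
        - ((c * h i) ^ 3 / 6) *\<^sub>R m i (m i (m i (u i)))))
      + h i ^ 1 *\<^sub>R (a2 *\<^sub>R (k2 i - stage c2 0 0 0 i) + a3 *\<^sub>R (k3 i - stage c3 e3 q3 0 i))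
      + h i ^ 4 *\<^sub>R (a2 *\<^sub>R p c2 0 0 0 i + a3 *\<^sub>R p c3 e3 q3 0 i)" for i
    unfolding incr_def st c
    by (simp add: vec_eq_iff g_def[of i]) (simp add: field_simps eval_nat_numeral)
  have sh: "dom (\<lambda>i. h i ^ 1 *\<^sub>R (a2 *\<^sub>R (k2 i - stage c2 0 0 0 i) + a3 *\<^sub>R (k3 i - stage c3 e3 q3 0 i))) (\<lambda>i. h i ^ 4)"
    using dom_h_shift[of _ 3 1, OF dominated_add[OF dominated_scaleR[OF dominated_const k1(1)] dominated_scaleR[OF dominated_const k1(2)]]]
    by simp
  show ?thesis
    unfolding id by (intro dominated_add t sh dom_h_mult bounded_intros P)
qed

end

subsection \<open>Expansion of the numerical step\<close>

lemma node_simps: "node a 2 = a 2 1" "node a 3 = a 3 1 + a 3 2" "node a 4 = a 4 1 + a 4 2 + a 4 3"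
proof -
  have "{1..<2::nat} = {1}" "{1..<3::nat} = {1, 2}" "{1..<4::nat} = {1, 2, 3}" by auto
  then show "node a 2 = a 2 1" "node a 3 = a 3 1 + a 3 2" "node a 4 = a 4 1 + a 4 2 + a 4 3"
    by (simp_all add: node_def)
qed

lemma jacobian_eq_ddirs:
  fixes f :: "real^'n \<Rightarrow> real^'k"
  assumes "f differentiable (at x)"
  shows "jacobian f (at x) *v v = ddirs [v] f x"
  using assms jacobian_works[of f "at x"] ddir_eqI[of f "(*v) (jacobian f (at x))"] by simp

context point_family
begin

lemma f_differentiable: "f differentiable (at x)"
  by (rule C_diff_differentiable[of 0], rule C_diff_mono[OF smooth]) simp

lemma correction_eq:
  "sverk4_correction (M i) f (h i) (u i) =
     - (h i ^ 2 / 2) *\<^sub>R m i (F i)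
     + (h i ^ 3 / 6) *\<^sub>R (m i (m i (F i)) - J i (m i (F i)) - m i (J i (g i)))
     + (h i ^ 4 / 24) *\<^sub>R
         (- m i (m i (m i (F i))) + J i (m i (m i (F i))) + m i (m i (J i (g i))) - m i (H i (g i) (g i))
          + m i (J i (m i (g i))) - m i (J i (J i (g i))) - J i (m i (J i (g i)))
          - J i (J i (m i (F i))) - 3 *\<^sub>R H i (g i) (m i (F i)))"
proof -
  have J: "jacobian f (at (u i)) *v x = J i x" for x
    unfolding J_def by (rule jacobian_eq_ddirs[OF f_differentiable])
  have H: "second_deriv f (u i) = H i"
    by (intro ext) (simp only: second_deriv_eq_ddirs H_def)
  have g: "- (M i *v u i) + f (u i) = g i"
    by (simp add: g_def m_def F_def)
  \<comment> \<open>A fixed order of arguments lets the mixed terms cancel in the identity for the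
    whole step.\<close>
  have comm: "H i (m i (F i)) (g i) = H i (g i) (m i (F i))"
    unfolding H_def by (rule deriv2_commute)
  have neg: "(- A) *v x = - (A *v x)" for A :: "real^'n^'n" and x
    using matrix_vector_mult_diff_rdistrib[of 0 A x] by simp
  show ?thesis
    unfolding sverk4_correction_def Let_def g H
    unfolding F_def[symmetric] matrix_vector_mult_diff_rdistrib
      matrix_vector_mult_add_rdistrib neg J m_def[symmetric] lin_simps comm
    by (simp add: fact_reduce eval_nat_numeral)
qed

text \<open>Up to order \<open>h ^ 3\<close> the weighted stage sum is a combination of elementary
  terms whose coefficients are the left sides of the order conditions. Once these are numbers, no
  trace of the particular method is left to compare.\<close>

lemma step_expansion:
  assumes order1: "b 1 + b 2 + b 3 + b 4 = 1"
    and order2: "b 2 * node a 2 + b 3 * node a 3 + b 4 * node a 4 = 1 / 2"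
    and order3a: "b 2 * node a 2 ^ 2 + b 3 * node a 3 ^ 2 + b 4 * node a 4 ^ 2 = 1 / 3"
    and order3b: "b 3 * a 3 2 * node a 2 + b 4 * a 4 2 * node a 2 + b 4 * a 4 3 * node a 3 = 1 / 6"
    and order4a: "b 2 * node a 2 ^ 3 + b 3 * node a 3 ^ 3 + b 4 * node a 4 ^ 3 = 1 / 4"
    and order4b: "b 3 * node a 3 * a 3 2 * node a 2 + b 4 * node a 4 * a 4 2 * node a 2
                    + b 4 * node a 4 * a 4 3 * node a 3 = 1 / 8"
    and order4c: "b 3 * a 3 2 * node a 2 ^ 2 + b 4 * a 4 2 * node a 2 ^ 2
                    + b 4 * a 4 3 * node a 3 ^ 2 = 1 / 12"
    and order4d: "b 4 * a 4 3 * a 3 2 * node a 2 = 1 / 24"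
  shows "dom (\<lambda>i. sverk4_step (M i) f a b (h i) (u i) - flow i (h i)) (\<lambda>i. h i ^ 5)"
proof -
  define c2 c3 c4 where c: "c2 = node a 2" "c3 = node a 3" "c4 = node a 4"
  define k2 where "k2 i = f (E c2 i (u i) + h i *\<^sub>R (a 2 1 *\<^sub>R F i))" for i
  define k3 where "k3 i = f (E c3 i (u i) + h i *\<^sub>R (a 3 1 *\<^sub>R F i + a 3 2 *\<^sub>R k2 i))" for i
  define k4 where "k4 i = f (E c4 i (u i) + h i *\<^sub>R (a 4 1 *\<^sub>R F i + a 4 2 *\<^sub>R k2 i + a 4 3 *\<^sub>R k3 i))" for i
  define e4 where "e4 = a 4 2 * c2 + a 4 3 * c3"
  define q4 where "q4 = a 4 2 * c2\<^sup>2 + a 4 3 * c3\<^sup>2"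
  \<comment> \<open>Fills the predecessor slots that carry coefficient 0 in stages two and
    three.\<close>
  have z: "dom (\<lambda>i. stage c e q s i - stage c e q s i) (\<lambda>i. h i ^ 4)" for c e q s
    by (simp add: dominated_zero)
  have s2: "dom (\<lambda>i. k2 i - stage c2 0 0 0 i) (\<lambda>i. h i ^ 4)"
    using stage_expansion[OF incr_expansion[OF z[of 0 0 0 0] z[of 0 0 0 0], of c2 "a 2 1" 0 0]]
    by (simp add: k2_def c node_simps)
  have s3: "dom (\<lambda>i. k3 i - stage c3 (a 3 2 * c2) (a 3 2 * c2\<^sup>2) 0 i) (\<lambda>i. h i ^ 4)"
    using stage_expansion[OF incr_expansion[OF s2 z[of 0 0 0 0], of c3 "a 3 1" "a 3 2" 0]]
    by (simp add: k3_def c node_simps)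
  have s4: "dom (\<lambda>i. k4 i - stage c4 e4 q4 (a 4 3 * (a 3 2 * c2)) i) (\<lambda>i. h i ^ 4)"
    using stage_expansion[OF incr_expansion[OF s2 s3, of c4 "a 4 1" "a 4 2" "a 4 3"]]
    by (simp add: k4_def c node_simps e4_def q4_def)
  have step: "sverk4_step (M i) f a b (h i) (u i)
      = E 1 i (u i) + h i *\<^sub>R (b 1 *\<^sub>R F i + b 2 *\<^sub>R k2 i + b 3 *\<^sub>R k3 i + b 4 *\<^sub>R k4 i)
        + sverk4_correction (M i) f (h i) (u i)" for i
    unfolding sverk4_step_def Let_def k4_def k3_def k2_def c E_def F_def by simp
  define \<beta> where "\<beta> i = b 1 *\<^sub>R F i + b 2 *\<^sub>R stage c2 0 0 0 i + b 3 *\<^sub>R stage c3 (a 3 2 * c2) (a 3 2 * c2\<^sup>2) 0 i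
      + b 4 *\<^sub>R stage c4 e4 q4 (a 4 3 * (a 3 2 * c2)) i" for i
  have \<beta>: "\<beta> i = F i + (h i / 2) *\<^sub>R J i (g i)
      + (h i ^ 2 / 6) *\<^sub>R (J i (m i (m i (u i))) + H i (g i) (g i) + J i (J i (g i)))
      + (h i ^ 3 / 24) *\<^sub>R (3 *\<^sub>R H i (g i) (m i (m i (u i))) - J i (m i (m i (m i (u i)))) + K i (g i) (g i) (g i)
          + J i (J i (m i (m i (u i))) + H i (g i) (g i)) + J i (J i (J i (g i))) + 3 *\<^sub>R H i (g i) (J i (g i)))" for i
  proof -
    define X2 where "X2 = (1/2) *\<^sub>R (J i (m i (m i (u i))) + H i (g i) (g i))"
    define X4 where "X4 = (1/2) *\<^sub>R H i (g i) (m i (m i (u i))) - (1/6) *\<^sub>R J i (m i (m i (m i (u i))))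
            + (1/6) *\<^sub>R K i (g i) (g i) (g i)"
    define X5 where "X5 = (1/2) *\<^sub>R J i (J i (m i (m i (u i))) + H i (g i) (g i))"
    \<comment> \<open>Grouped so that each bracket is literally the left side of one order condition
      and can be rewritten.\<close>
    have "\<beta> i = (b 1 + b 2 + b 3 + b 4) *\<^sub>R F i
        + (h i * (b 2 * node a 2 + b 3 * node a 3 + b 4 * node a 4)) *\<^sub>R J i (g i)
        + (h i ^ 2 * (b 2 * node a 2 ^ 2 + b 3 * node a 3 ^ 2 + b 4 * node a 4 ^ 2)) *\<^sub>R X2
        + (h i ^ 2 * (b 3 * a 3 2 * node a 2 + b 4 * a 4 2 * node a 2 + b 4 * a 4 3 * node a 3)) *\<^sub>R J i (J i (g i))
        + (h i ^ 3 * (b 2 * node a 2 ^ 3 + b 3 * node a 3 ^ 3 + b 4 * node a 4 ^ 3)) *\<^sub>R X4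
        + (h i ^ 3 * (b 3 * a 3 2 * node a 2 ^ 2 + b 4 * a 4 2 * node a 2 ^ 2 + b 4 * a 4 3 * node a 3 ^ 2)) *\<^sub>R X5
        + (h i ^ 3 * (b 4 * a 4 3 * a 3 2 * node a 2)) *\<^sub>R J i (J i (J i (g i)))
        + (h i ^ 3 * (b 3 * node a 3 * a 3 2 * node a 2 + b 4 * node a 4 * a 4 2 * node a 2
                    + b 4 * node a 4 * a 4 3 * node a 3)) *\<^sub>R H i (g i) (J i (g i))"
      unfolding \<beta>_def stage_def X2_def[symmetric] X4_def[symmetric] X5_def[symmetric] c[symmetric] e4_def q4_def
      by (simp add: vec_eq_iff) (simp add: algebra_simps)
    then show ?thesis
      unfolding order1 order2 order3a order3b order4a order4b order4c order4d X2_def X4_def X5_def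
      by (simp add: vec_eq_iff) (simp add: algebra_simps add_divide_distrib diff_divide_distrib)
  qed
  have t: "dom (\<lambda>i. E 1 i (u i) - (u i - h i *\<^sub>R m i (u i) + (h i ^ 2 / 2) *\<^sub>R m i (m i (u i))
        - (h i ^ 3 / 6) *\<^sub>R m i (m i (m i (u i))) + (h i ^ 4 / 24) *\<^sub>R m i (m i (m i (m i (u i)))))) (\<lambda>i. h i ^ 5)"
    using dom_E_taylor[OF dom_u, of 1 5] by (simp add: eval_nat_numeral fact_reduce m_def algebra_simps)
  have id: "sverk4_step (M i) f a b (h i) (u i) - flow i (h i)
      = (E 1 i (u i) - (u i - h i *\<^sub>R m i (u i) + (h i ^ 2 / 2) *\<^sub>R m i (m i (u i))
          - (h i ^ 3 / 6) *\<^sub>R m i (m i (m i (u i))) + (h i ^ 4 / 24) *\<^sub>R m i (m i (m i (m i (u i))))))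
        + h i ^ 1 *\<^sub>R (b 2 *\<^sub>R (k2 i - stage c2 0 0 0 i)
           + b 3 *\<^sub>R (k3 i - stage c3 (a 3 2 * c2) (a 3 2 * c2\<^sup>2) 0 i)
           + b 4 *\<^sub>R (k4 i - stage c4 e4 q4 (a 4 3 * (a 3 2 * c2)) i))" for i
  proof -
    have 1: "h i *\<^sub>R (b 1 *\<^sub>R F i + b 2 *\<^sub>R k2 i + b 3 *\<^sub>R k3 i + b 4 *\<^sub>R k4 i)
        = h i *\<^sub>R \<beta> i + h i ^ 1 *\<^sub>R (b 2 *\<^sub>R (k2 i - stage c2 0 0 0 i)
           + b 3 *\<^sub>R (k3 i - stage c3 (a 3 2 * c2) (a 3 2 * c2\<^sup>2) 0 i)
           + b 4 *\<^sub>R (k4 i - stage c4 e4 q4 (a 4 3 * (a 3 2 * c2)) i))"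
      unfolding \<beta>_def by (simp add: algebra_simps)
    \<comment> \<open>The shape of the correction is decisive here: added to the truncated
      exponential and the quadrature it yields the Taylor polynomial of the flow exactly, without a
      further remainder.\<close>
    have 2: "(u i - h i *\<^sub>R m i (u i) + (h i ^ 2 / 2) *\<^sub>R m i (m i (u i))
          - (h i ^ 3 / 6) *\<^sub>R m i (m i (m i (u i))) + (h i ^ 4 / 24) *\<^sub>R m i (m i (m i (m i (u i)))))
        + h i *\<^sub>R \<beta> i + sverk4_correction (M i) f (h i) (u i) = flow i (h i)"
    proof -
      \<comment> \<open>With \<open>F\<close> eliminated, both sides consist of the same words in
        \<open>m\<close>, \<open>J\<close>, \<open>H\<close> and \<open>K\<close> over
        \<open>g\<close> and \<open>u\<close>, and coefficients can be compared.\<close>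
      have F: "F i = g i + m i (u i)" by (simp add: g_def)
      show ?thesis
        unfolding \<beta> correction_eq flow_def flow4_def flow3_def flow2_def F lin_simps
        by (simp add: vec_eq_iff)
          (simp add: algebra_simps eval_nat_numeral add_divide_distrib diff_divide_distrib)
    qed
    have "e + (y + r) + w - (p + y + w) = (e - p) + r" for e y r w p :: "real^'n"
      by simp
    then show ?thesis unfolding step 1 2[symmetric] .
  qed
  have r: "dom (\<lambda>i. h i ^ 1 *\<^sub>R (b 2 *\<^sub>R (k2 i - stage c2 0 0 0 i)
           + b 3 *\<^sub>R (k3 i - stage c3 (a 3 2 * c2) (a 3 2 * c2\<^sup>2) 0 i)
           + b 4 *\<^sub>R (k4 i - stage c4 e4 q4 (a 4 3 * (a 3 2 * c2)) i))) (\<lambda>i. h i ^ 5)"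
    using dom_h_shift[of _ 4 1, OF dominated_add[OF dominated_add[OF dominated_scaleR[OF dominated_const s2]
          dominated_scaleR[OF dominated_const s3]] dominated_scaleR[OF dominated_const s4]]] by simp
  show ?thesis unfolding id by (rule dominated_add[OF t r])
qed

end

section \<open>Dependence of the step on the starting point\<close>

locale pair_family = semilinear_family S M f h \<mu> T
  for S :: "'i set" and M :: "'i \<Rightarrow> real^'n^'n" and f :: "real^'n \<Rightarrow> real^'n"
    and h :: "'i \<Rightarrow> real" and \<mu> T :: real +
  fixes u v :: "'i \<Rightarrow> real^'n"
  assumes dom_u: "dominated S u (\<lambda>i. 1)" and dom_v: "dominated S v (\<lambda>i. 1)"
begin

sublocale U: point_family S M f h \<mu> T u by standard (rule dom_u)
sublocale V: point_family S M f h \<mu> T v by standard (rule dom_v)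

text \<open>\<open>X\<close> and \<open>Y\<close> stand for one expression evaluated from
  \<open>u\<close> and from \<open>v\<close>. Boundedness is part of the notion because multilinear
  terms and \<open>f\<close> preserve Lipschitz dependence only on bounded sets.\<close>

definition close :: "('i \<Rightarrow> 'b::real_normed_vector) \<Rightarrow> ('i \<Rightarrow> 'b) \<Rightarrow> bool" where
  "close X Y \<longleftrightarrow> dom X (\<lambda>i. 1) \<and> dom Y (\<lambda>i. 1) \<and> dom (\<lambda>i. X i - Y i) (\<lambda>i. norm (u i - v i))"

lemma close_uv: "close u v"
  unfolding close_def using dom_u dom_v by (auto intro: dominatedI[of _ _ 1])

lemma close_add:
  assumes "close X Y" "close X' Y'" shows "close (\<lambda>i. X i + X' i) (\<lambda>i. Y i + Y' i)"
proof -
  have "(\<lambda>i. X i + X' i - (Y i + Y' i)) = (\<lambda>i. (X i - Y i) + (X' i - Y' i))" by auto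
  then show ?thesis using assms unfolding close_def by (auto intro: dominated_add)
qed

lemma close_scaleR:
  assumes "dom r (\<lambda>i. 1)" "close X Y" shows "close (\<lambda>i. r i *\<^sub>R X i) (\<lambda>i. r i *\<^sub>R Y i)"
  using assms unfolding close_def scaleR_diff_right[symmetric] by (auto intro: dominated_scaleR)

lemma close_minus: "close X Y \<Longrightarrow> close (\<lambda>i. - X i) (\<lambda>i. - Y i)"
  using close_scaleR[OF dominated_const[of S "-1"]] by simp

lemma close_diff: "close X Y \<Longrightarrow> close X' Y' \<Longrightarrow> close (\<lambda>i. X i - X' i) (\<lambda>i. Y i - Y' i)"
  using close_add[OF _ close_minus, of X Y X' Y'] by simp

lemma close_M: "close X Y \<Longrightarrow> close (\<lambda>i. M i *v X i) (\<lambda>i. M i *v Y i)"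
  unfolding close_def matrix_vector_mult_diff_distrib[symmetric] by (auto intro: dom_M)

lemma E_diff: "E c i (x - y) = E c i x - E c i y"
  by (simp add: E_def matrix_vector_mult_diff_distrib)

lemma close_E: "close X Y \<Longrightarrow> close (\<lambda>i. E c i (X i)) (\<lambda>i. E c i (Y i))"
  unfolding close_def E_diff[symmetric] by (auto intro: dom_E)

text \<open>Only the base point moves here. A Lipschitz bound for derivatives of order
  \<open>l\<close> costs one more derivative, whence \<open>l \<le> 3\<close>.\<close>

lemma dom_point_diff:
  assumes X: "dom X (\<lambda>i. 1)" and Y: "dom Y (\<lambda>i. 1)" and XY: "dom (\<lambda>i. X i - Y i) w"
    and l: "l \<le> 3" "\<And>i. length (vs i) = l" and vs: "dom (\<lambda>i. prod_list (map norm (vs i))) (\<lambda>i. 1)"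
  shows "dom (\<lambda>i. ddirs (vs i) f (X i) - ddirs (vs i) f (Y i)) w"
proof -
  obtain A where A: "\<And>i. i \<in> S \<Longrightarrow> norm (X i) \<le> A * 1" using X dominatedE by blast
  obtain A' where A': "\<And>i. i \<in> S \<Longrightarrow> norm (Y i) \<le> A' * 1" using Y dominatedE by blast
  have "C_diff (Suc l) f" by (rule C_diff_mono[OF smooth]) (use l in simp)
  then obtain B where B: "B \<ge> 0" "\<And>u v vs. norm u \<le> max A A' \<Longrightarrow> norm v \<le> max A A' \<Longrightarrow> length vs = l \<Longrightarrow>
      norm (ddirs vs f u - ddirs vs f v) \<le> B * prod_list (map norm vs) * norm (u - v)"
    using ddirs_lipschitz[of l f "max A A'"] by blast
  have "norm (ddirs (vs i) f (X i) - ddirs (vs i) f (Y i)) \<le> B * prod_list (map norm (vs i)) * norm (X i - Y i)"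
    if "i \<in> S" for i
    by (rule B(2)) (use A[OF that] A'[OF that] l in auto)
  from dominated_le[OF this B(1) vs XY[folded dominated_norm[of _ "\<lambda>i. X i - Y i"]]]
  show ?thesis by simp
qed

lemma close_f:
  assumes "close X Y" shows "close (\<lambda>i. f (X i)) (\<lambda>i. f (Y i))"
  using dom_point_diff[of X Y _ 0 "\<lambda>i. []"] assms unfolding close_def
  by (auto intro: dom_f dominated_const)

lemma close_deriv1:
  assumes "close X Y" shows "close (\<lambda>i. ddirs [X i] f (u i)) (\<lambda>i. ddirs [Y i] f (v i))"
proof -
  have X: "dom X (\<lambda>i. 1)" "dom Y (\<lambda>i. 1)" "dom (\<lambda>i. X i - Y i) (\<lambda>i. norm (u i - v i))"
    using assms unfolding close_def by auto
  \<comment> \<open>First the direction changes at the fixed point \<open>u\<close>, then the point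
    changes under the fixed direction \<open>Y\<close>.\<close>
  have "ddirs [X i] f (u i) - ddirs [Y i] f (v i)
      = ddirs [X i - Y i] f (u i) + (ddirs [Y i] f (u i) - ddirs [Y i] f (v i))" for i
    unfolding linear_diff[OF linear_deriv(1)] by (simp del: foldr.simps)
  moreover have "dom (\<lambda>i. ddirs [Y i] f (u i) - ddirs [Y i] f (v i)) (\<lambda>i. norm (u i - v i))"
    by (rule dom_point_diff[OF dom_u dom_v, of _ 1])
      (use X(2) in \<open>auto simp: dominated_norm intro: dominatedI[of _ _ 1]\<close>)
  ultimately show ?thesis unfolding close_def
    by (simp only:) (intro conjI dom_deriv1 dom_u dom_v X dominated_add)
qed

lemma close_deriv2:
  assumes "close X Y" "close X' Y'"
  shows "close (\<lambda>i. ddirs [X i, X' i] f (u i)) (\<lambda>i. ddirs [Y i, Y' i] f (v i))"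
proof -
  have X: "dom X (\<lambda>i. 1)" "dom Y (\<lambda>i. 1)" "dom (\<lambda>i. X i - Y i) (\<lambda>i. norm (u i - v i))"
    and X': "dom X' (\<lambda>i. 1)" "dom Y' (\<lambda>i. 1)" "dom (\<lambda>i. X' i - Y' i) (\<lambda>i. norm (u i - v i))"
    using assms unfolding close_def by auto
  have "ddirs [X i, X' i] f (u i) - ddirs [Y i, Y' i] f (v i)
      = ddirs [X i - Y i, X' i] f (u i) + ddirs [Y i, X' i - Y' i] f (u i)
        + (ddirs [Y i, Y' i] f (u i) - ddirs [Y i, Y' i] f (v i))" for i
    unfolding linear_diff[OF linear_deriv(2)] linear_diff[OF linear_deriv(3)] by (simp del: foldr.simps)
  moreover have "dom (\<lambda>i. ddirs [Y i, Y' i] f (u i) - ddirs [Y i, Y' i] f (v i)) (\<lambda>i. norm (u i - v i))"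
  proof (rule dom_point_diff[OF dom_u dom_v, of _ 2])
    show "dom (\<lambda>i. prod_list (map norm [Y i, Y' i])) (\<lambda>i. 1)"
      using dominated_times[of S "\<lambda>i. norm (Y i)" "\<lambda>i. norm (Y' i)"] X(2) X'(2)
      by (simp add: dominated_norm)
  qed (auto intro: dominatedI[of _ _ 1])
  moreover have "dom (\<lambda>i. ddirs [X i - Y i, X' i] f (u i)) (\<lambda>i. norm (u i - v i))"
    using dom_deriv2_mult[OF dom_u X(3) X'(1)] by (simp del: foldr.simps)
  moreover have "dom (\<lambda>i. ddirs [Y i, X' i - Y' i] f (u i)) (\<lambda>i. norm (u i - v i))"
    using dom_deriv2_mult[OF dom_u X(2) X'(3)] by (simp del: foldr.simps)
  moreover have "dom (\<lambda>i. ddirs [X i, X' i] f (u i)) (\<lambda>i. 1)" "dom (\<lambda>i. ddirs [Y i, Y' i] f (v i)) (\<lambda>i. 1)"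
    using dom_deriv2_mult[OF dom_u X(1) X'(1)] dom_deriv2_mult[OF dom_v X(2) X'(2)] by (simp_all del: foldr.simps)
  ultimately show ?thesis unfolding close_def
    by (simp only: dominated_add simp_thms)
qed

lemma close_m: "close X Y \<Longrightarrow> close (\<lambda>i. U.m i (X i)) (\<lambda>i. V.m i (Y i))"
  unfolding U.m_def V.m_def by (rule close_M)

lemma close_J: "close X Y \<Longrightarrow> close (\<lambda>i. U.J i (X i)) (\<lambda>i. V.J i (Y i))"
  unfolding U.J_def V.J_def by (rule close_deriv1)

lemma close_H: "close X Y \<Longrightarrow> close X' Y' \<Longrightarrow> close (\<lambda>i. U.H i (X i) (X' i)) (\<lambda>i. V.H i (Y i) (Y' i))"
  unfolding U.H_def V.H_def by (rule close_deriv2)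

lemma close_F: "close U.F V.F"
  unfolding U.F_def[abs_def] V.F_def[abs_def] by (rule close_f[OF close_uv])

lemma close_g: "close U.g V.g"
  unfolding U.g_def[abs_def] V.g_def[abs_def] by (intro close_add close_minus close_m close_uv close_F)


text \<open>All of the step except the exponential carries a factor \<open>h\<close>, and the
  exponential differs from the identity by O(h). Subtracting \<open>u i - v i\<close> exposes this
  factor, which a mere Lipschitz bound would hide.\<close>

lemma step_lipschitz:
  shows "dom (\<lambda>i. sverk4_step (M i) f a b (h i) (u i)) (\<lambda>i. 1)"
    and "dom (\<lambda>i. sverk4_step (M i) f a b (h i) (u i) - sverk4_step (M i) f a b (h i) (v i) - (u i - v i))
      (\<lambda>i. h i * norm (u i - v i))"
proof -
  define k2 where "k2 i x = f (E (node a 2) i x + h i *\<^sub>R (a 2 1 *\<^sub>R f x))" for i x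
  define k3 where "k3 i x = f (E (node a 3) i x + h i *\<^sub>R (a 3 1 *\<^sub>R f x + a 3 2 *\<^sub>R k2 i x))" for i x
  define k4 where "k4 i x = f (E (node a 4) i x + h i *\<^sub>R (a 4 1 *\<^sub>R f x + a 4 2 *\<^sub>R k2 i x + a 4 3 *\<^sub>R k3 i x))" for i x
  note rules = close_add close_diff close_minus close_scaleR[OF dominated_const] close_scaleR[OF dom_h]
    close_scaleR[OF dom_h_power] close_f close_E close_uv close_m close_J close_H close_F close_g
  have c2: "close (\<lambda>i. k2 i (u i)) (\<lambda>i. k2 i (v i))" unfolding k2_def by (intro rules)
  have c3: "close (\<lambda>i. k3 i (u i)) (\<lambda>i. k3 i (v i))" unfolding k3_def by (intro rules c2)
  have c4: "close (\<lambda>i. k4 i (u i)) (\<lambda>i. k4 i (v i))" unfolding k4_def by (intro rules c2 c3)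
  \<comment> \<open>\<open>UQ\<close> and \<open>VQ\<close> are the correction terms at
    \<open>u\<close> and at \<open>v\<close> with one factor \<open>h\<close> taken out.\<close>
  define UQ where "UQ i = - (h i ^ 1 *\<^sub>R (1/2) *\<^sub>R U.m i (U.F i))
     + h i ^ 2 *\<^sub>R (1 / 6) *\<^sub>R (U.m i (U.m i (U.F i)) - U.J i (U.m i (U.F i)) - U.m i (U.J i (U.g i)))
     + h i ^ 3 *\<^sub>R (1 / 24) *\<^sub>R
         (- U.m i (U.m i (U.m i (U.F i))) + U.J i (U.m i (U.m i (U.F i))) + U.m i (U.m i (U.J i (U.g i))) - U.m i (U.H i (U.g i) (U.g i))
          + U.m i (U.J i (U.m i (U.g i))) - U.m i (U.J i (U.J i (U.g i))) - U.J i (U.m i (U.J i (U.g i)))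
          - U.J i (U.J i (U.m i (U.F i))) - 3 *\<^sub>R U.H i (U.g i) (U.m i (U.F i)))" for i
  define VQ where "VQ i = - (h i ^ 1 *\<^sub>R (1/2) *\<^sub>R V.m i (V.F i))
     + h i ^ 2 *\<^sub>R (1 / 6) *\<^sub>R (V.m i (V.m i (V.F i)) - V.J i (V.m i (V.F i)) - V.m i (V.J i (V.g i)))
     + h i ^ 3 *\<^sub>R (1 / 24) *\<^sub>R
         (- V.m i (V.m i (V.m i (V.F i))) + V.J i (V.m i (V.m i (V.F i))) + V.m i (V.m i (V.J i (V.g i))) - V.m i (V.H i (V.g i) (V.g i))
          + V.m i (V.J i (V.m i (V.g i))) - V.m i (V.J i (V.J i (V.g i))) - V.J i (V.m i (V.J i (V.g i)))
          - V.J i (V.J i (V.m i (V.F i))) - 3 *\<^sub>R V.H i (V.g i) (V.m i (V.F i)))" for i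
  have Q: "close UQ VQ" unfolding UQ_def[abs_def] VQ_def[abs_def] by (intro rules)
  define X where "X i = b 1 *\<^sub>R f (u i) + b 2 *\<^sub>R k2 i (u i) + b 3 *\<^sub>R k3 i (u i) + b 4 *\<^sub>R k4 i (u i) + UQ i" for i
  define Y where "Y i = b 1 *\<^sub>R f (v i) + b 2 *\<^sub>R k2 i (v i) + b 3 *\<^sub>R k3 i (v i) + b 4 *\<^sub>R k4 i (v i) + VQ i" for i
  have XY: "close X Y" unfolding X_def[abs_def] Y_def[abs_def] by (intro rules c2 c3 c4 Q)
  have U: "sverk4_step (M i) f a b (h i) (u i) = E 1 i (u i) + h i *\<^sub>R X i" for i
    unfolding sverk4_step_def Let_def U.correction_eq X_def UQ_def k4_def k3_def k2_def E_def
    by (simp add: algebra_simps eval_nat_numeral)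
  have V: "sverk4_step (M i) f a b (h i) (v i) = E 1 i (v i) + h i *\<^sub>R Y i" for i
    unfolding sverk4_step_def Let_def V.correction_eq Y_def VQ_def k4_def k3_def k2_def E_def
    by (simp add: algebra_simps eval_nat_numeral)
  have "close (\<lambda>i. E 1 i (u i) + h i *\<^sub>R X i) (\<lambda>i. E 1 i (v i) + h i *\<^sub>R Y i)"
    by (intro rules XY)
  then show "dom (\<lambda>i. sverk4_step (M i) f a b (h i) (u i)) (\<lambda>i. 1)"
    unfolding U close_def by simp
  have "dom (\<lambda>i. u i - v i) (\<lambda>i. norm (u i - v i))" using close_uv unfolding close_def by simp
  \<comment> \<open>Expansion to order one with the distance as weight: the exponential minus the
    identity contributes \<open>h\<close> times the distance.\<close>
  from dom_E_taylor[OF this, of 1 1]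
  have e: "dom (\<lambda>i. E 1 i (u i - v i) - (u i - v i)) (\<lambda>i. h i * norm (u i - v i))" by simp
  have "dom h h" by (rule dominatedI[of _ _ 1]) (use h_nonneg in auto)
  then have "dom (\<lambda>i. h i *\<^sub>R (X i - Y i)) (\<lambda>i. h i * norm (u i - v i))"
    using XY unfolding close_def by (intro dominated_mult) auto
  from dominated_add[OF e this]
  show "dom (\<lambda>i. sverk4_step (M i) f a b (h i) (u i) - sverk4_step (M i) f a b (h i) (v i) - (u i - v i))
      (\<lambda>i. h i * norm (u i - v i))"
    unfolding U V E_diff by (simp add: algebra_simps)
qed

end

section \<open>The exact solution\<close>

lemma vector_derivative_bound:
  fixes z :: "real \<Rightarrow> 'a::real_normed_vector"
  assumes "\<And>s. s \<in> {0..h} \<Longrightarrow> (z has_vector_derivative z' s) (at s within {0..h})"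
    and "\<And>s. s \<in> {0..h} \<Longrightarrow> norm (z' s) \<le> B" and s: "s \<in> {0..h}"
  shows "norm (z s - z 0) \<le> B * s"
proof -
  have "norm (z s - z 0) \<le> B * norm (s - 0)"
  proof (rule differentiable_bound[of "{0..h}" z "\<lambda>s r. r *\<^sub>R z' s"])
    show "onorm (\<lambda>r. r *\<^sub>R z' s) \<le> B" if "s \<in> {0..h}" for s
      using assms(2)[OF that] order_trans[OF norm_ge_zero assms(2)[OF that]]
      by (intro onorm_bound) (auto simp: mult.commute[of B] intro!: mult_left_mono)
  qed (use assms s in \<open>auto simp: has_vector_derivative_def\<close>)
  then show ?thesis using s by simp
qed

lemma short_gronwall:
  fixes z :: "real \<Rightarrow> 'a::real_normed_vector"
  assumes d: "\<And>s. s \<in> {0..h} \<Longrightarrow> (z has_vector_derivative z' s) (at s within {0..h})"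
    and b: "\<And>s. s \<in> {0..h} \<Longrightarrow> norm (z' s) \<le> K * norm (z s) + D"
    and z0: "z 0 = 0" and h: "0 \<le> h" "K * h \<le> 1 / 2" and K: "0 \<le> K" and D: "0 \<le> D"
  shows "norm (z h) \<le> 2 * D * h"
proof -
  have "continuous_on {0..h} z"
    unfolding continuous_on_eq_continuous_within using d has_vector_derivative_continuous by blast
  then obtain t where t: "t \<in> {0..h}" "\<And>s. s \<in> {0..h} \<Longrightarrow> norm (z s) \<le> norm (z t)"
    using continuous_attains_sup[of "{0..h}" "\<lambda>s. norm (z s)", OF compact_Icc _ continuous_on_norm] h
    by (metis atLeastatMost_empty_iff2 not_le)
  let ?m = "norm (z t)"
  have "norm (z' s) \<le> K * ?m + D" if "s \<in> {0..h}" for s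
    using b[OF that] mult_left_mono[OF t(2)[OF that] K] by linarith
  from vector_derivative_bound[OF d this t(1)]
  have "?m \<le> (K * ?m + D) * t" by (simp add: z0)
  also have "\<dots> \<le> (K * ?m + D) * h"
    using t(1) K D by (intro mult_left_mono) auto
  also have "\<dots> = (K * h) * ?m + D * h" by (simp add: algebra_simps)
  also have "\<dots> \<le> 1 / 2 * ?m + D * h" using h by (intro add_right_mono mult_right_mono) auto
  finally have "?m \<le> 2 * D * h" by simp
  then show ?thesis using t(2)[of h] h by simp
qed

lemma solves_semilinearD:
  assumes "solves_semilinear M f t0 tend y0 y" "t \<in> {t0..tend}"
  shows "(y has_vector_derivative - (M *v y t) + f (y t)) (at t within {t0..tend})"
proof -
  obtain y' where y': "(y has_vector_derivative y') (at t within {t0..tend})" "y' + M *v y t = f (y t)"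
    using assms unfolding solves_semilinear_def by blast
  then have "y' = - (M *v y t) + f (y t)" by (simp add: algebra_simps)
  then show ?thesis using y'(1) by simp
qed

lemma solution_in_strip:
  assumes "t \<in> {t0..tend}"
  shows "y t \<in> strip t0 tend y"
proof -
  have "bdd_below ((\<lambda>s. norm (y s - y t)) ` {t0..tend})"
    by (rule bdd_belowI[of _ 0]) auto
  then have "(INF s\<in>{t0..tend}. norm (y s - y t)) \<le> norm (y t - y t)"
    using assms by (rule cINF_lower)
  then show ?thesis by (simp add: strip_def)
qed

text \<open>The bound mentions neither \<open>M\<close> nor \<open>y\<close>, so one ball contains
  the solutions for all admissible matrices. The smooth quantity
  \<open>w s \<bullet> w s + 1\<close> replaces the norm, which is not differentiable at
  zero.\<close>

lemma solution_bounded: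
  fixes f :: "real^'n \<Rightarrow> real^'n"
  assumes L: "L > 0" and sol: "solves_semilinear M f t0 tend y0 y"
    and lip: "L-lipschitz_on (strip t0 tend y) f" and M: "onorm ((*v) M) = \<mu>"
    and t: "t \<in> {t0..tend}"
  shows "norm (y t) \<le> norm y0 + exp ((2 * (\<mu> + L) + (\<mu> * norm y0 + norm (f y0))) * (tend - t0))"
proof -
  define \<beta> where "\<beta> = \<mu> * norm y0 + norm (f y0)"
  \<comment> \<open>Chosen so that the derivative of \<open>w s \<bullet> w s + 1\<close> is at most
    \<open>K\<close> times this quantity; the extra \<open>\<beta>\<close> pays for the linear term
    through \<open>2 * n \<le> n\<^sup>2 + 1\<close>.\<close>
  define K where "K = 2 * (\<mu> + L) + \<beta>"
  define w where "w s = y s - y0" for s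
  define w' where "w' s = - (M *v y s) + f (y s)" for s
  have Mle: "norm (M *v x) \<le> \<mu> * norm x" for x
    using onorm[of "(*v) M" x] M by simp
  have \<mu>: "0 \<le> \<mu>" using onorm_pos_le[of "(*v) M"] M by simp
  have \<beta>: "0 \<le> \<beta>" using \<mu> by (simp add: \<beta>_def)
  have K: "0 \<le> K" using \<mu> \<beta> L by (simp add: K_def)
  have y0: "y t0 = y0" using sol by (simp add: solves_semilinear_def)
  have w'_le: "norm (w' s) \<le> (\<mu> + L) * norm (w s) + \<beta>" if s: "s \<in> {t0..tend}" for s
  proof -
    have "norm (f (y s) - f (y t0)) \<le> L * norm (y s - y t0)"
      using lipschitz_onD[OF lip solution_in_strip[OF s] solution_in_strip[of t0]] t
      by (simp add: dist_norm)
    then have 1: "norm (f (y s) - f y0) \<le> L * norm (w s)" by (simp add: y0 w_def)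
    have "w' s = - (M *v w s) - M *v y0 + (f (y s) - f y0) + f y0"
      by (simp add: w'_def w_def matrix_vector_mult_diff_distrib)
    also have "norm \<dots> \<le> norm (M *v w s) + norm (M *v y0) + norm (f (y s) - f y0) + norm (f y0)"
      by norm
    also have "\<dots> \<le> (\<mu> + L) * norm (w s) + \<beta>"
      using Mle[of "w s"] Mle[of y0] 1 by (simp add: \<beta>_def algebra_simps)
    finally show ?thesis .
  qed
  define Q where "Q s = exp (- K * s) * (w s \<bullet> w s + 1)" for s
  define Q' where "Q' s = exp (- K * s) * (2 * (w s \<bullet> w' s) - K * (w s \<bullet> w s + 1))" for s
  have wd: "(w has_vector_derivative w' s) (at s within {t0..tend})" if "s \<in> {t0..tend}" for s
    unfolding w_def[abs_def] w'_def using solves_semilinearD[OF sol that]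
    by (auto intro!: derivative_eq_intros)
  have Qd: "(Q has_derivative (\<lambda>r. Q' s * r)) (at s within {t0..t})" if s: "s \<in> {t0..t}" for s
  proof -
    have "s \<in> {t0..tend}" using s t by auto
    from has_vector_derivative_within_subset[OF wd[OF this]]
    have "(w has_derivative (\<lambda>r. r *\<^sub>R w' s)) (at s within {t0..t})"
      using t by (auto simp: has_vector_derivative_def)
    then show ?thesis unfolding Q_def[abs_def] Q'_def
      by (auto intro!: derivative_eq_intros simp: algebra_simps inner_commute)
  qed
  have "Q' s \<le> 0" if s: "s \<in> {t0..t}" for s
  proof -
    let ?n = "norm (w s)"
    have "w s \<bullet> w' s \<le> ?n * norm (w' s)" by (rule norm_cauchy_schwarz)
    also have "\<dots> \<le> ?n * ((\<mu> + L) * ?n + \<beta>)"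
      using w'_le[of s] s t by (intro mult_left_mono) auto
    finally have "2 * (w s \<bullet> w' s) \<le> 2 * (\<mu> + L) * ?n\<^sup>2 + \<beta> * (2 * ?n)"
      by (simp add: power2_eq_square algebra_simps)
    also have "\<beta> * (2 * ?n) \<le> \<beta> * (?n\<^sup>2 + 1)"
      using sum_squares_bound[of ?n 1] by (intro mult_left_mono \<beta>) simp
    also have "2 * (\<mu> + L) * ?n\<^sup>2 + \<beta> * (?n\<^sup>2 + 1) \<le> K * (?n\<^sup>2 + 1)"
      using \<mu> L by (simp add: K_def algebra_simps)
    finally show ?thesis
      unfolding Q'_def by (simp add: mult_le_0_iff power2_norm_eq_inner)
  qed
  moreover obtain x where "x \<in> {t0..t}" "Q t - Q t0 = Q' x * (t - t0)"
    using mvt_very_simple[of t0 t Q "\<lambda>s r. Q' s * r"] Qd t by auto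
  ultimately have "Q t - Q t0 \<le> 0" using t by (auto intro: mult_nonpos_nonneg)
  then have "Q t \<le> Q t0" by simp
  moreover have "Q t0 = exp (- K * t0)" by (simp add: Q_def w_def y0)
  ultimately have "exp (K * t) * Q t \<le> exp (K * t) * exp (- K * t0)"
    by (intro mult_left_mono) auto
  also have "exp (K * t) * Q t = norm (w t) ^ 2 + 1"
    by (simp add: Q_def power2_norm_eq_inner exp_minus field_simps)
  also have "exp (K * t) * exp (- K * t0) = exp (K * (t - t0))"
    by (simp add: algebra_simps flip: exp_add)
  also have "\<dots> \<le> exp (K * (tend - t0))"
    using t K by (simp add: mult_left_mono)
  finally have "norm (w t) ^ 2 + 1 \<le> exp (K * (tend - t0))" .
  moreover have "2 * norm (w t) \<le> norm (w t) ^ 2 + 1"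
    using sum_squares_bound[of "norm (w t)" 1] by simp
  then have "norm (w t) \<le> norm (w t) ^ 2 + 1"
    using norm_ge_zero[of "w t"] by linarith
  moreover have "norm (y t) \<le> norm y0 + norm (w t)"
    using norm_triangle_ineq[of y0 "w t"] by (simp add: w_def)
  ultimately show ?thesis unfolding K_def \<beta>_def by linarith
qed

section \<open>Local and global error\<close>

lemma (in point_family) dom_flow: "dom (\<lambda>i. flow i (h i)) (\<lambda>i. 1)"
proof -
  have "flow i (h i) = u i + h i ^ 1 *\<^sub>R g i + h i ^ 2 *\<^sub>R (1/2) *\<^sub>R flow2 i + h i ^ 3 *\<^sub>R (1/6) *\<^sub>R flow3 i
      + h i ^ 4 *\<^sub>R (1/24) *\<^sub>R flow4 i" for i
    by (simp add: flow_def)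
  then show ?thesis
    by (simp only:) (intro bounded_intros dominated_scaleR[OF dom_h_power] dom_flow_coeffs)
qed

lemma (in point_family) flow_derivative:
  "(flow i has_vector_derivative flow' i s) (at s within A)"
  unfolding flow_def[abs_def] flow'_def
  by (auto intro!: derivative_eq_intros simp: eval_nat_numeral)

lemma local_error:
  fixes f :: "real^'n \<Rightarrow> real^'n" and a :: "nat \<Rightarrow> nat \<Rightarrow> real" and b :: "nat \<Rightarrow> real"
  assumes smooth: "C_diff 4 f" and R: "0 \<le> R"
    and order1: "b 1 + b 2 + b 3 + b 4 = 1"
    and order2: "b 2 * node a 2 + b 3 * node a 3 + b 4 * node a 4 = 1 / 2"
    and order3a: "b 2 * node a 2 ^ 2 + b 3 * node a 3 ^ 2 + b 4 * node a 4 ^ 2 = 1 / 3"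
    and order3b: "b 3 * a 3 2 * node a 2 + b 4 * a 4 2 * node a 2 + b 4 * a 4 3 * node a 3 = 1 / 6"
    and order4a: "b 2 * node a 2 ^ 3 + b 3 * node a 3 ^ 3 + b 4 * node a 4 ^ 3 = 1 / 4"
    and order4b: "b 3 * node a 3 * a 3 2 * node a 2 + b 4 * node a 4 * a 4 2 * node a 2
                    + b 4 * node a 4 * a 4 3 * node a 3 = 1 / 8"
    and order4c: "b 3 * a 3 2 * node a 2 ^ 2 + b 4 * a 4 2 * node a 2 ^ 2
                    + b 4 * a 4 3 * node a 3 ^ 2 = 1 / 12"
    and order4d: "b 4 * a 4 3 * a 3 2 * node a 2 = 1 / 24"
  obtains C h0 where "0 \<le> C" "0 < h0"
    "\<And>(M :: real^'n^'n) y t h. \<lbrakk>onorm ((*v) M) = \<mu>; solves_semilinear M f t0 tend y0 y;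
       \<forall>s\<in>{t0..tend}. norm (y s) \<le> R; t0 \<le> t; t + h \<le> tend; 0 \<le> h; h \<le> h0\<rbrakk>
      \<Longrightarrow> norm (sverk4_step M f a b h (y t) - y (t + h)) \<le> C * h ^ 5"
proof -
  \<comment> \<open>The last component is the step size in the numerical expansion, and the running
    time between 0 and \<open>h\<close> in the residual of the polynomial.\<close>
  define S :: "((real^'n^'n) \<times> (real^'n) \<times> real) set"
    where "S = {(M, u, s). onorm ((*v) M) = \<mu> \<and> norm u \<le> R \<and> 0 \<le> s \<and> s \<le> 1}"
  interpret P: point_family S fst f "\<lambda>i. snd (snd i)" \<mu> 1 "\<lambda>i. fst (snd i)"
    by standard (use smooth in \<open>auto simp: S_def simp del: C_diff.simps intro!: dominatedI[of _ _ R]\<close>)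
  obtain C1 where C1: "0 \<le> C1" and step: "\<And>i. i \<in> S \<Longrightarrow>
      norm (sverk4_step (fst i) f a b (snd (snd i)) (fst (snd i)) - P.flow i (snd (snd i))) \<le> C1 * snd (snd i) ^ 5"
    using P.step_expansion[OF order1 order2 order3a order3b order4a order4b order4c order4d] dominatedE by blast
  obtain C2 where C2: "0 \<le> C2" and residual: "\<And>i. i \<in> S \<Longrightarrow>
      norm (P.flow' i (snd (snd i)) - (- P.m i (P.flow i (snd (snd i))) + f (P.flow i (snd (snd i)))))
        \<le> C2 * snd (snd i) ^ 4"
    using P.flow_residual dominatedE by blast
  obtain R' where R': "\<And>i. i \<in> S \<Longrightarrow> norm (P.flow i (snd (snd i))) \<le> R' * 1"
    using P.dom_flow dominatedE by blast
  have "C_diff (Suc 0) f" by (rule C_diff_mono[OF smooth]) simp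
  then obtain B where B: "0 \<le> B" "\<And>u v vs. norm u \<le> max R R' \<Longrightarrow> norm v \<le> max R R' \<Longrightarrow> length vs = 0 \<Longrightarrow>
      norm (ddirs vs f u - ddirs vs f v) \<le> B * prod_list (map norm vs) * norm (u - v)"
    using ddirs_lipschitz[of 0 f "max R R'"] by blast
  define K where "K = \<bar>\<mu>\<bar> + B"
  have K: "0 \<le> K" using B(1) by (simp add: K_def)
  \<comment> \<open>Keeps the indices in \<open>S\<close> and gives \<open>K * h \<le> 1 / 2\<close>
    for \<open>short_gronwall\<close>.\<close>
  define h0 where "h0 = min 1 (1 / (2 * (K + 1)))"
  show thesis
  proof (rule that)
    show "0 \<le> C1 + 2 * C2" "0 < h0" using C1 C2 K by (auto simp: h0_def)
    fix M :: "real^'n^'n" and y t h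
    assume M: "onorm ((*v) M) = \<mu>" and sol: "solves_semilinear M f t0 tend y0 y"
      and yR: "\<forall>s\<in>{t0..tend}. norm (y s) \<le> R" and t: "t0 \<le> t" "t + h \<le> tend"
      and h: "0 \<le> h" "h \<le> h0"
    have "K * h \<le> K * (1 / (2 * (K + 1)))" using h K by (intro mult_left_mono) (auto simp: h0_def)
    also have "\<dots> \<le> 1 / 2" using K by (simp add: field_simps)
    finally have Kh: "K * h \<le> 1 / 2" .
    \<comment> \<open>The coefficients ignore the last component of the index, so the entry 0 is a
      dummy.\<close>
    define p where "p = P.flow (M, y t, 0)"
    define p' where "p' = P.flow' (M, y t, 0)"
    have flow_eq: "P.flow (M, y t, s) = p" "P.flow' (M, y t, s) = p'" for s
      unfolding p_def p'_def P.flow_def[abs_def] P.flow'_def[abs_def] P.flow4_def P.flow3_def P.flow2_def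
        P.g_def P.F_def P.m_def P.J_def P.H_def P.K_def by simp_all
    have inS: "(M, y t, s) \<in> S" if "s \<in> {0..h}" for s
      using that M yR t h by (auto simp: S_def h0_def)
    define z where "z s = y (t + s) - p s" for s
    define z' where "z' s = (- (M *v y (t + s)) + f (y (t + s))) - p' s" for s
    have "norm (z h) \<le> 2 * (C2 * h ^ 4) * h"
    proof (rule short_gronwall[OF _ _ _ h(1) Kh K])
      fix s assume s: "s \<in> {0..h}"
      have "t + s \<in> {t0..tend}" using s t by auto
      from solves_semilinearD[OF sol this]
      have yd: "(y has_vector_derivative - (M *v y (t + s)) + f (y (t + s))) (at (t + s) within {t0..tend})" .
      have "((\<lambda>s. y (t + s)) has_vector_derivative 1 *\<^sub>R (- (M *v y (t + s)) + f (y (t + s)))) (at s within {0..h})"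
      proof (rule vector_diff_chain_within[of "\<lambda>s. t + s" 1 s "{0..h}" y, unfolded o_def])
        show "((\<lambda>s. t + s) has_vector_derivative 1) (at s within {0..h})"
          by (auto intro!: derivative_eq_intros)
        show "(y has_vector_derivative - (M *v y (t + s)) + f (y (t + s))) (at (t + s) within (+) t ` {0..h})"
          by (rule has_vector_derivative_within_subset[OF yd]) (use t in auto)
      qed
      then show "(z has_vector_derivative z' s) (at s within {0..h})"
        unfolding z_def[abs_def] z'_def
        using P.flow_derivative[of "(M, y t, 0)" s "{0..h}"] unfolding p_def[symmetric] p'_def[symmetric]
        by (intro has_vector_derivative_diff) auto
      have "norm (p' s - (- (M *v p s) + f (p s))) \<le> C2 * s ^ 4"
        using residual[OF inS[OF s]] by (simp add: flow_eq P.m_def)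
      also have "C2 * s ^ 4 \<le> C2 * h ^ 4" using s C2 by (intro mult_left_mono power_mono) auto
      finally have r: "norm (p' s - (- (M *v p s) + f (p s))) \<le> C2 * h ^ 4" .
      have "norm (p s) \<le> R'" using R'[OF inS[OF s]] by (simp add: flow_eq)
      moreover have "norm (y (t + s)) \<le> R" using yR s t by auto
      ultimately have fz: "norm (f (y (t + s)) - f (p s)) \<le> B * norm (z s)"
        using B(2)[of "y (t + s)" "p s" "[]"] by (simp add: z_def)
      have "norm (M *v z s) \<le> \<bar>\<mu>\<bar> * norm (z s)"
        using onorm[of "(*v) M" "z s"] M abs_ge_self[of \<mu>] mult_right_mono[of \<mu> "\<bar>\<mu>\<bar>" "norm (z s)"] by simp
      moreover have "z' s = - (M *v z s) + (f (y (t + s)) - f (p s)) - (p' s - (- (M *v p s) + f (p s)))"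
        by (simp add: z'_def z_def matrix_vector_mult_diff_distrib)
      then have "norm (z' s) \<le> norm (M *v z s) + norm (f (y (t + s)) - f (p s)) + norm (p' s - (- (M *v p s) + f (p s)))"
        using norm_triangle_ineq4[of "- (M *v z s) + (f (y (t + s)) - f (p s))" "p' s - (- (M *v p s) + f (p s))"]
          norm_triangle_ineq[of "- (M *v z s)" "f (y (t + s)) - f (p s)"] by simp
      ultimately show "norm (z' s) \<le> K * norm (z s) + C2 * h ^ 4"
        using fz r by (simp add: K_def algebra_simps)
    next
      show "z 0 = 0" by (simp add: z_def p_def P.flow_def)
      show "0 \<le> C2 * h ^ 4" using C2 h by simp
    qed
    moreover have "norm (sverk4_step M f a b h (y t) - p h) \<le> C1 * h ^ 5"
      using step[OF inS[of h]] h by (simp add: flow_eq)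
    moreover have "norm (sverk4_step M f a b h (y t) - y (t + h)) \<le> norm (sverk4_step M f a b h (y t) - p h) + norm (z h)"
      unfolding z_def by norm
    ultimately show "norm (sverk4_step M f a b h (y t) - y (t + h)) \<le> (C1 + 2 * C2) * h ^ 5"
      by (simp add: algebra_simps eval_nat_numeral)
  qed
qed

section \<open>Stability and accumulation of errors\<close>

lemma step_stability:
  fixes f :: "real^'n \<Rightarrow> real^'n"
  assumes smooth: "C_diff 4 f"
  obtains B C where "0 \<le> C"
    "\<And>(M :: real^'n^'n) u h. \<lbrakk>onorm ((*v) M) = \<mu>; norm u \<le> R; 0 \<le> h; h \<le> T\<rbrakk>
      \<Longrightarrow> norm (sverk4_step M f a b h u) \<le> B"
    "\<And>(M :: real^'n^'n) u v h. \<lbrakk>onorm ((*v) M) = \<mu>; norm u \<le> R; norm v \<le> R; 0 \<le> h; h \<le> T\<rbrakk>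
      \<Longrightarrow> norm (sverk4_step M f a b h u - sverk4_step M f a b h v) \<le> (1 + C * h) * norm (u - v)"
proof -
  define S :: "((real^'n^'n) \<times> (real^'n) \<times> (real^'n) \<times> real) set"
    where "S = {(M, u, v, h). onorm ((*v) M) = \<mu> \<and> norm u \<le> R \<and> norm v \<le> R \<and> 0 \<le> h \<and> h \<le> T}"
  interpret P: pair_family S fst f "\<lambda>i. snd (snd (snd i))" \<mu> T "\<lambda>i. fst (snd i)" "\<lambda>i. fst (snd (snd i))"
    by standard (use smooth in \<open>auto simp: S_def simp del: C_diff.simps intro!: dominatedI[of _ _ R]\<close>)
  let ?\<Phi> = "\<lambda>i. sverk4_step (fst i) f a b (snd (snd (snd i)))"
  obtain B where B: "\<And>i. i \<in> S \<Longrightarrow> norm (?\<Phi> i (fst (snd i))) \<le> B * 1"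
    using P.step_lipschitz(1) dominatedE by blast
  obtain C where C: "0 \<le> C" "\<And>i. i \<in> S \<Longrightarrow> norm (?\<Phi> i (fst (snd i)) - ?\<Phi> i (fst (snd (snd i)))
      - (fst (snd i) - fst (snd (snd i)))) \<le> C * (snd (snd (snd i)) * norm (fst (snd i) - fst (snd (snd i))))"
    using P.step_lipschitz(2) dominatedE by blast
  show thesis
  proof (rule that[OF C(1)])
    fix M :: "real^'n^'n" and u :: "real^'n" and h assume "onorm ((*v) M) = \<mu>" "norm u \<le> R" "0 \<le> h" "h \<le> T"
    then show "norm (sverk4_step M f a b h u) \<le> B" using B[of "(M, u, u, h)"] by (simp add: S_def)
  next
    fix M :: "real^'n^'n" and u v :: "real^'n" and h
    assume "onorm ((*v) M) = \<mu>" "norm u \<le> R" "norm v \<le> R" "0 \<le> h" "h \<le> T"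
    then have "norm (sverk4_step M f a b h u - sverk4_step M f a b h v - (u - v)) \<le> C * (h * norm (u - v))"
      using C(2)[of "(M, u, v, h)"] by (simp add: S_def)
    then show "norm (sverk4_step M f a b h u - sverk4_step M f a b h v) \<le> (1 + C * h) * norm (u - v)"
      using norm_triangle_sub[of "sverk4_step M f a b h u - sverk4_step M f a b h v" "u - v"]
      by (simp add: algebra_simps)
  qed
qed

text \<open>The bound may grow arbitrarily with \<open>n\<close>; it is meant for step sizes bounded
  below, where only finitely many \<open>n\<close> occur.\<close>

lemma sverk4_bounded:
  fixes f :: "real^'n \<Rightarrow> real^'n"
  assumes smooth: "C_diff 4 f"
  shows "\<exists>B. \<forall>(M :: real^'n^'n) h. onorm ((*v) M) = \<mu> \<and> 0 \<le> h \<and> h \<le> T \<longrightarrow> norm (sverk4 M f a b h y0 n) \<le> B"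
proof (induction n)
  case (Suc n)
  then obtain R where R: "\<And>(M :: real^'n^'n) h. onorm ((*v) M) = \<mu> \<Longrightarrow> 0 \<le> h \<Longrightarrow> h \<le> T \<Longrightarrow> norm (sverk4 M f a b h y0 n) \<le> R"
    by blast
  show ?case
    by (rule step_stability[OF smooth, of \<mu> R T a b]) (use R in \<open>simp, blast\<close>)
qed auto

text \<open>A discrete Gronwall argument with a bootstrap: the recursion is available only while
  \<open>e k \<le> 1\<close>, and the bound proved so far, by \<open>small\<close>, is itself at
  most 1 and so keeps it available.\<close>

lemma global_error:
  fixes e :: "nat \<Rightarrow> real"
  assumes e0: "e 0 = 0" and h: "0 \<le> h" and C: "0 \<le> C" "0 \<le> K"
    and step: "\<And>k. Suc k \<le> n \<Longrightarrow> e k \<le> 1 \<Longrightarrow> e (Suc k) \<le> (1 + K * h) * e k + C * h ^ 5"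
    and T: "real n * h \<le> T" and small: "C * T * exp (K * T) * h ^ 4 \<le> 1"
  shows "e n \<le> C * T * exp (K * T) * h ^ 4"
proof -
  have bound: "real k * h * (1 + K * h) ^ k * (C * h ^ 4) \<le> C * T * exp (K * T) * h ^ 4" if "k \<le> n" for k
  proof -
    have kT: "real k * h \<le> T" using that T h mult_right_mono[of "real k" "real n" h] by simp
    have "(1 + K * h) ^ k \<le> exp (K * h) ^ k"
      using h C by (intro power_mono exp_ge_add_one_self) auto
    also have "\<dots> = exp (K * (real k * h))" by (simp add: exp_of_nat_mult[symmetric] algebra_simps)
    also have "\<dots> \<le> exp (K * T)" using kT C by (simp add: mult_left_mono)
    finally have "real k * h * (1 + K * h) ^ k \<le> T * exp (K * T)"
      using kT h C order_trans[OF _ kT, of 0] by (intro mult_mono) auto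
    from mult_right_mono[OF this, of "C * h ^ 4"] show ?thesis
      using C h by (simp add: mult_ac)
  qed
  have "e k \<le> real k * h * (1 + K * h) ^ k * (C * h ^ 4)" if "k \<le> n" for k
    using that
  proof (induction k)
    case (Suc k)
    have IH: "e k \<le> real k * h * (1 + K * h) ^ k * (C * h ^ 4)" using Suc by simp
    moreover have "e k \<le> 1" using IH bound[of k] small Suc.prems by linarith
    ultimately have "e (Suc k) \<le> (1 + K * h) * (real k * h * (1 + K * h) ^ k * (C * h ^ 4)) + C * h ^ 5"
      using step[OF Suc.prems] mult_left_mono[OF IH, of "1 + K * h"] C h by simp
    \<comment> \<open>Enlarging the new local error by the full growth factor makes it the next of
      \<open>Suc k\<close> equal contributions.\<close>
    also have "C * h ^ 5 \<le> (1 + K * h) ^ Suc k * (C * h ^ 5)"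
      using mult_right_mono[OF one_le_power[of "1 + K * h" "Suc k"], of "C * h ^ 5"] C h by simp
    finally show ?case by (simp add: algebra_simps eval_nat_numeral)
  qed (simp add: e0)
  then show ?thesis using bound[of n] order_trans by blast
qed

theorem theorem4p2:
  fixes f :: "real^'n \<Rightarrow> real^'n" and y0 :: "real^'n"
    and a :: "nat \<Rightarrow> nat \<Rightarrow> real" and b :: "nat \<Rightarrow> real"
    and t0 tend L \<mu> :: real
  assumes smooth: "C_diff 4 f"
    and interval: "t0 \<le> tend"
    and L_pos: "L > 0"
    and order1: "b 1 + b 2 + b 3 + b 4 = 1"
    and order2: "b 2 * node a 2 + b 3 * node a 3 + b 4 * node a 4 = 1 / 2"
    and order3a: "b 2 * node a 2 ^ 2 + b 3 * node a 3 ^ 2 + b 4 * node a 4 ^ 2 = 1 / 3"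
    and order3b: "b 3 * a 3 2 * node a 2 + b 4 * a 4 2 * node a 2 + b 4 * a 4 3 * node a 3 = 1 / 6"
    and order4a: "b 2 * node a 2 ^ 3 + b 3 * node a 3 ^ 3 + b 4 * node a 4 ^ 3 = 1 / 4"
    and order4b: "b 3 * node a 3 * a 3 2 * node a 2 + b 4 * node a 4 * a 4 2 * node a 2
                    + b 4 * node a 4 * a 4 3 * node a 3 = 1 / 8"
    and order4c: "b 3 * a 3 2 * node a 2 ^ 2 + b 4 * a 4 2 * node a 2 ^ 2
                    + b 4 * a 4 3 * node a 3 ^ 2 = 1 / 12"
    and order4d: "b 4 * a 4 3 * a 3 2 * node a 2 = 1 / 24"
  shows "\<exists>C. \<forall>(M :: real^'n^'n) y.
           (symmetric_pos_def M \<or> skew_hermitian M) \<and> onorm ((*v) M) = \<mu> \<and>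
           solves_semilinear M f t0 tend y0 y \<and> L-lipschitz_on (strip t0 tend y) f
           \<longrightarrow> (\<forall>h n. h > 0 \<and> 1 \<le> n \<and> real n \<le> (tend - t0) / h
                  \<longrightarrow> norm (sverk4 M f a b h y0 n - y (t0 + real n * h)) \<le> C * h ^ 4)"
proof -
  define T where "T = tend - t0"
  have T: "0 \<le> T" using interval by (simp add: T_def)
  define R where "R = norm y0 + exp ((2 * (\<mu> + L) + (\<mu> * norm y0 + norm (f y0))) * T)"
  have R: "0 \<le> R" by (simp add: R_def)
  obtain C1 h0 where C1: "0 \<le> C1" "0 < h0" and local_err: "\<And>(M :: real^'n^'n) y t h.
      \<lbrakk>onorm ((*v) M) = \<mu>; solves_semilinear M f t0 tend y0 y;
       \<forall>s\<in>{t0..tend}. norm (y s) \<le> R; t0 \<le> t; t + h \<le> tend; 0 \<le> h; h \<le> h0\<rbrakk>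
      \<Longrightarrow> norm (sverk4_step M f a b h (y t) - y (t + h)) \<le> C1 * h ^ 5"
    by (rule local_error[OF smooth R order1 order2 order3a order3b order4a order4b order4c order4d,
          of \<mu> t0 tend y0]) (rule that)
  \<comment> \<open>The margin 1 in the radius matches the condition \<open>e k \<le> 1\<close> of
    \<open>global_error\<close>: a numerical value that close to the solution lies in this
    ball.\<close>
  obtain B' C2 where C2: "0 \<le> C2" and stable: "\<And>(M :: real^'n^'n) u v h.
      \<lbrakk>onorm ((*v) M) = \<mu>; norm u \<le> R + 1; norm v \<le> R + 1; 0 \<le> h; h \<le> T\<rbrakk>
      \<Longrightarrow> norm (sverk4_step M f a b h u - sverk4_step M f a b h v) \<le> (1 + C2 * h) * norm (u - v)"
    by (rule step_stability[OF smooth, of \<mu> "R + 1" T a b]) (rule that)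
  define D where "D = C1 * T * exp (C2 * T)"
  have D: "0 \<le> D" using C1 T by (simp add: D_def)
  \<comment> \<open>Below \<open>h1\<close> the local error bound applies, and
    \<open>h ^ 4 \<le> h \<le> 1 / (D + 1)\<close> gives \<open>D * h ^ 4 \<le> 1\<close>.\<close>
  define h1 where "h1 = min h0 (min 1 (1 / (D + 1)))"
  have h1: "0 < h1" using C1 D by (simp add: h1_def)
  obtain B where B: "\<And>n (M :: real^'n^'n) h. onorm ((*v) M) = \<mu> \<Longrightarrow> 0 \<le> h \<Longrightarrow> h \<le> T
      \<Longrightarrow> norm (sverk4 M f a b h y0 n) \<le> B n"
    using sverk4_bounded[OF smooth, of \<mu> T a b y0] by metis
  \<comment> \<open>For \<open>h > h1\<close> the number of steps is at most
    \<open>T / h1\<close>.\<close>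
  define N where "N = nat \<lceil>T / h1\<rceil>"
  define Q where "Q = Max (B ` {..N})"
  \<comment> \<open>The second entry covers \<open>h > h1\<close>: the error is at most
    \<open>\<bar>Q\<bar> + R\<close>, and \<open>h1 ^ 4 \<le> h ^ 4\<close>.\<close>
  define C where "C = max D ((\<bar>Q\<bar> + R) / h1 ^ 4)"
  have "norm (sverk4 M f a b h y0 n - y (t0 + real n * h)) \<le> C * h ^ 4"
    if M: "onorm ((*v) M) = \<mu>" and sol: "solves_semilinear M f t0 tend y0 y"
      and lip: "L-lipschitz_on (strip t0 tend y) f" and h: "0 < h" and n: "1 \<le> n" "real n \<le> T / h"
    for M :: "real^'n^'n" and y h n
  proof -
    have yR: "norm (y t) \<le> R" if "t \<in> {t0..tend}" for t
      unfolding R_def T_def by (rule solution_bounded[OF L_pos sol lip M that])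
    have nh: "real n * h \<le> T" using n(2) h by (simp add: field_simps)
    \<comment> \<open>Here \<open>1 \<le> n\<close> matters: it forces \<open>h \<le> T\<close>, as
      the stability bounds require.\<close>
    have "h \<le> real n * h" using n(1) h by simp
    then have hT: "h \<le> T" using nh by linarith
    have tk: "t0 + real k * h \<in> {t0..tend}" if "k \<le> n" for k
    proof -
      have "real k * h \<le> real n * h" "0 \<le> real k * h" using that h by (auto intro: mult_right_mono)
      then show ?thesis using nh unfolding T_def atLeastAtMost_iff by linarith
    qed
    show ?thesis
    proof (cases "h \<le> h1")
      case True
      then have hh: "h \<le> h0" "h \<le> 1" "h \<le> 1 / (D + 1)" by (auto simp: h1_def)
      define e where "e k = norm (sverk4 M f a b h y0 k - y (t0 + real k * h))" for k
      have "h ^ 4 \<le> h" using power_decreasing[of 1 4 h] hh(2) h by simp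
      then have "D * h ^ 4 \<le> D * (1 / (D + 1))" using hh(3) D by (intro mult_left_mono) auto
      also have "\<dots> \<le> 1" using D by (simp add: field_simps)
      finally have small: "D * h ^ 4 \<le> 1" .
      have "e n \<le> C1 * T * exp (C2 * T) * h ^ 4"
      proof (rule global_error[OF _ _ C1(1) C2 _ nh])
        show "e 0 = 0" using sol by (simp add: e_def solves_semilinear_def)
        fix k assume k: "Suc k \<le> n" and ek: "e k \<le> 1"
        let ?u = "sverk4 M f a b h y0 k" and ?t = "t0 + real k * h"
        have y: "norm (y ?t) \<le> R" using yR tk k by simp
        have u: "norm ?u \<le> R + 1"
          using norm_triangle_sub[of ?u "y ?t"] y ek by (simp add: e_def)
        have t': "t0 + real (Suc k) * h = ?t + h" by (simp add: algebra_simps)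
        have loc: "norm (sverk4_step M f a b h (y ?t) - y (?t + h)) \<le> C1 * h ^ 5"
          using local_err[OF M sol, of ?t h] yR tk[OF k] hh h unfolding t' by simp
        have st: "norm (sverk4_step M f a b h ?u - sverk4_step M f a b h (y ?t)) \<le> (1 + C2 * h) * e k"
          unfolding e_def using stable[OF M u, of "y ?t" h] y h hT by simp
        \<comment> \<open>The old error is propagated by the numerical step, and the local error is
          taken at the exact solution.\<close>
        have "e (Suc k) = norm ((sverk4_step M f a b h ?u - sverk4_step M f a b h (y ?t))
            + (sverk4_step M f a b h (y ?t) - y (?t + h)))"
          unfolding e_def t' by simp
        also have "\<dots> \<le> (1 + C2 * h) * e k + C1 * h ^ 5"
          by (rule norm_triangle_le) (use loc st in linarith)
        finally show "e (Suc k) \<le> (1 + C2 * h) * e k + C1 * h ^ 5" .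
      qed (use h small in \<open>auto simp: D_def\<close>)
      also have "\<dots> \<le> C * h ^ 4" using h by (intro mult_right_mono) (auto simp: C_def D_def)
      finally show ?thesis by (simp add: e_def)
    next
      case False
      then have "T / h \<le> T / h1" using h1 T h by (intro divide_left_mono) auto
      then have "n \<le> N" using n(2) unfolding N_def by linarith
      then have "B n \<le> \<bar>Q\<bar>" unfolding Q_def
        by (intro order_trans[OF Max_ge[of _ "B n"] abs_ge_self]) auto
      then have "norm (sverk4 M f a b h y0 n) \<le> \<bar>Q\<bar>"
        using B[OF M, of h n] h hT by simp
      moreover have "norm (y (t0 + real n * h)) \<le> R" by (rule yR[OF tk]) simp
      ultimately have "norm (sverk4 M f a b h y0 n - y (t0 + real n * h)) \<le> \<bar>Q\<bar> + R"
        using norm_triangle_ineq4[of "sverk4 M f a b h y0 n" "y (t0 + real n * h)"] by linarith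
      also have "\<dots> = (\<bar>Q\<bar> + R) / h1 ^ 4 * h1 ^ 4" using h1 by simp
      also have "\<dots> \<le> C * h ^ 4"
        using False h1 R by (intro mult_mono power_mono) (auto simp: C_def le_max_iff_disj)
      finally show ?thesis .
    qed
  qed
  then show ?thesis unfolding T_def by blast
qed

end
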